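(* A point of the Cartesian plane is an origami point if and only if it is an ML-point. The fields $\mathbb{O}$ and $\mathbb{L}$ are isomorphic.
   Context: Work in the Cartesian plane $\mathbb{R}^2$. Origami points: for a line $t$, let $P^t$ denote the reflection of the point $P$ in $t$. A line is an origami line if it is the last of a finite sequence of lines $t_1,\dots,t_n$ such that each line of the sequence is either one of the starting lines $x=0$, $y=0$, $x+y=1$, or is a line $t$ for which there are lines $p,q$ and points $P,Q$ with $P^t\in p$ and $Q^t\in q$, where: $p$ and $q$ are non-parallel lines occurring earlier in the sequence; $P$ and $Q$ are distinct points, each of which is the intersection of two lines occurring earlier in the sequence; and either $q$ is the line through $P$ and $Q$, or $p\perp q$. An origami point is a point that is the intersection of two (distinct) origami lines. A real number $x$ is an origami number if $(x,0)$ is an origami point. $\mathbb{O}$ denotes the set of origami numbers. ML-points (marked ruler): a point is an ML-point if it is the last of a finite sequence of points $P_1,\dots,P_n$ such that each point of the sequence is either in $\{(0,0),(0,1),(1,0)\}$ or is obtained (i) as the intersection point of two (distinct) lines, each through two (distinct) points occurring earlier in the sequence, or (ii) as one of two points that are at distance $1$ from each other, are collinear with a point occurring earlier in the sequence, and lie respectively on two different lines, each through two (distinct) points occurring earlier. A real number $x$ is an ML-number if $(x,0)$ is an ML-point. $\mathbb{L}$ denotes the set of ML-numbers. $\mathbb{O}$ and $\mathbb{L}$ are regarded as subfields of $\mathbb{R}$. *)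

theory Defs
  imports "HOL-Analysis.Analysis" "HOL-Algebra.Algebraic_Closure_Type"
begin

section \<open>Plane geometry\<close>

type_synonym point = "real \<times> real"

definition line_through :: "point \<Rightarrow> point \<Rightarrow> point set" where
  "line_through A B = affine hull {A, B}"

definition is_line :: "point set \<Rightarrow> bool" where
  "is_line t \<longleftrightarrow> (\<exists>A B. A \<noteq> B \<and> t = line_through A B)"

definition perpendicular :: "point set \<Rightarrow> point set \<Rightarrow> bool" where
  "perpendicular p q \<longleftrightarrow> (\<forall>A\<in>p. \<forall>B\<in>p. \<forall>C\<in>q. \<forall>D\<in>q. orthogonal (B - A) (D - C))"

text \<open>For a line \<open>t\<close>, the closest point of \<open>t\<close> to \<open>P\<close> is the foot of the perpendicular from \<open>P\<close>,
  and it is the midpoint of \<open>P\<close> and its mirror image.\<close>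

definition reflect_in :: "point set \<Rightarrow> point \<Rightarrow> point" where
  "reflect_in t P = 2 *\<^sub>R closest_point t P - P"

definition intersection_point :: "point set set \<Rightarrow> point \<Rightarrow> bool" where
  "intersection_point T P \<longleftrightarrow> (\<exists>l\<in>T. \<exists>m\<in>T. l \<noteq> m \<and> l \<inter> m = {P})"


section \<open>Origami points\<close>

definition origami_start :: "point set set" where
  "origami_start = {{(x, y). x = 0}, {(x, y). y = 0}, {(x, y). x + y = 1}}"

text \<open>A line is parallel to itself here (\<^const>\<open>affine_parallel\<close> is reflexive), so \<open>p \<noteq> q\<close>
  in a fold.\<close>

definition origami_fold :: "point set set \<Rightarrow> point set \<Rightarrow> bool" where
  "origami_fold T t \<longleftrightarrow> is_line t \<and>
     (\<exists>p\<in>T. \<exists>q\<in>T. \<exists>P Q.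
        \<not> affine_parallel p q \<and>
        P \<noteq> Q \<and> intersection_point T P \<and> intersection_point T Q \<and>
        (q = line_through P Q \<or> perpendicular p q) \<and>
        reflect_in t P \<in> p \<and> reflect_in t Q \<in> q)"

definition origami_sequence :: "point set list \<Rightarrow> bool" where
  "origami_sequence ts \<longleftrightarrow>
     (\<forall>i < length ts. ts ! i \<in> origami_start \<or> origami_fold (set (take i ts)) (ts ! i))"

definition origami_line :: "point set \<Rightarrow> bool" where
  "origami_line t \<longleftrightarrow> (\<exists>ts. ts \<noteq> [] \<and> origami_sequence ts \<and> last ts = t)"

definition origami_point :: "point \<Rightarrow> bool" where
  "origami_point P \<longleftrightarrow> intersection_point {t. origami_line t} P"

definition origami_numbers :: "real set" where
  "origami_numbers = {x. origami_point (x, 0)}"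


section \<open>Marked ruler points\<close>

definition lines_of :: "point set \<Rightarrow> point set set" where
  "lines_of S = {line_through A B | A B. A \<in> S \<and> B \<in> S \<and> A \<noteq> B}"

definition marked_ruler_start :: "point set" where
  "marked_ruler_start = {(0, 0), (0, 1), (1, 0)}"

text \<open>Either of the two points placed by the marked ruler may be the new point; since \<open>r\<close> and \<open>s\<close>
  range over the same lines, it suffices to call the new one \<open>P\<close>.\<close>

definition marking_step :: "point set \<Rightarrow> point \<Rightarrow> bool" where
  "marking_step S P \<longleftrightarrow>
     (\<exists>Q. \<exists>V\<in>S. \<exists>r\<in>lines_of S. \<exists>s\<in>lines_of S.
        r \<noteq> s \<and> P \<in> r \<and> Q \<in> s \<and> dist P Q = 1 \<and> collinear {V, P, Q})"

definition marked_ruler_sequence :: "point list \<Rightarrow> bool" where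
  "marked_ruler_sequence Ps \<longleftrightarrow>
     (\<forall>i < length Ps. Ps ! i \<in> marked_ruler_start \<or>
        intersection_point (lines_of (set (take i Ps))) (Ps ! i) \<or>
        marking_step (set (take i Ps)) (Ps ! i))"

definition marked_ruler_point :: "point \<Rightarrow> bool" where
  "marked_ruler_point P \<longleftrightarrow> (\<exists>Ps. Ps \<noteq> [] \<and> marked_ruler_sequence Ps \<and> last Ps = P)"

definition marked_ruler_numbers :: "real set" where
  "marked_ruler_numbers = {x. marked_ruler_point (x, 0)}"


section \<open>Subfields of the reals\<close>

abbreviation real_field :: "real ring" where
  "real_field \<equiv> ring_of_type_algebra"

end

(*
  Call a subfield of the reals cubic-closed if it contains every real root of a nonzero cubic
  polynomial over it. By Ferrari's method it then also contains the real roots of quartics.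

  Let K be cubic-closed. The slope of a crease is a root of a cubic over the field of the data, and
  the direction of the ruler in a marking step lies on the unit circle and on a conic, which gives a
  quartic for the tangent of half its angle. Hence the coordinates of all origami points and of all
  ML-points are in K.

  Conversely, both sets of numbers are cubic-closed. For origami, folding the origin and a second
  point to a vertical and a horizontal line realizes every cubic. For the ruler, marking along a line
  produces three equally spaced points on it and so its parallels, which give the field operations;
  a marking step with respect to a horizontal line and a second line solves the cubics.
  Each set of points is the square of its set of numbers, so the two sets of numbers contain each
  other.
*)

theory Submission
  imports Defs
begin

section \<open>Subfields of the reals that contain the roots of their cubics\<close>

text \<open>The common set of numbers is the least cubic-closed subfield of the reals, so the
  isomorphism is in fact an equality. \<open>K\<close> stays arbitrary while coordinates are
  bounded, so that each construction can be measured against the field of the other. The obstacle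
  throughout is degeneracy. Over \<open>K\<close>, the cubic or quartic has to be shown not to
  vanish identically. In the converse direction, one fold misses the cubics divisible by
  \<open>s^2 + 1\<close>, because its two points would coincide, and one marking yields only
  quartics whose leading and constant coefficients are opposite.\<close>

locale real_subfield =
  fixes K :: "real set"
  assumes one_mem: "1 \<in> K"
    and diff_mem: "a \<in> K \<Longrightarrow> b \<in> K \<Longrightarrow> a - b \<in> K"
    and divide_nonzero_mem: "a \<in> K \<Longrightarrow> b \<in> K \<Longrightarrow> b \<noteq> 0 \<Longrightarrow> a / b \<in> K"
begin

lemma zero_mem: "0 \<in> K"
  using diff_mem[OF one_mem one_mem] by simp

lemma uminus_mem: "a \<in> K \<Longrightarrow> - a \<in> K"
  using diff_mem[OF zero_mem] by simp

lemma add_mem: "a \<in> K \<Longrightarrow> b \<in> K \<Longrightarrow> a + b \<in> K"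
  using diff_mem[of a "- b"] uminus_mem by simp

text \<open>As \<open>a / 0 = 0\<close>, no side condition is left, and \<open>mem_intros\<close>
  applies blindly to quotients.\<close>

lemma divide_mem: "a \<in> K \<Longrightarrow> b \<in> K \<Longrightarrow> a / b \<in> K"
  using divide_nonzero_mem zero_mem by (cases "b = 0") auto

lemma mult_mem: "a \<in> K \<Longrightarrow> b \<in> K \<Longrightarrow> a * b \<in> K"
  using divide_mem[of a "1 / b"] divide_mem[OF one_mem] by simp

lemma power_mem: "a \<in> K \<Longrightarrow> a ^ n \<in> K"
  by (induction n) (auto intro: one_mem mult_mem)

lemma of_nat_mem: "of_nat n \<in> K"
  by (induction n) (auto intro: zero_mem one_mem add_mem)

lemma numeral_mem: "numeral n \<in> K"
  using of_nat_mem[of "numeral n"] by simp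

lemmas mem_intros = zero_mem one_mem diff_mem uminus_mem add_mem divide_mem mult_mem power_mem numeral_mem

lemma subfield: "subfield K real_field"
proof -
  interpret R: field real_field
    by (rule field_from_type_algebra)
  note [simp] = ring_of_type_algebra_def
  have neg: "\<ominus>\<^bsub>real_field\<^esub> x = - x" for x
    by (rule R.minus_equality) auto
  have sub: "subring K real_field"
    by (rule R.subringI) (auto simp: neg[unfolded ring_of_type_algebra_def] intro: mem_intros)
  show ?thesis
  proof (rule R.subfieldI'[OF sub])
    fix k assume k: "k \<in> K - {\<zero>\<^bsub>real_field\<^esub>}"
    then have "inv\<^bsub>real_field\<^esub> k = 1 / k"
      by (intro R.comm_inv_char) auto
    with k show "inv\<^bsub>real_field\<^esub> k \<in> K"
      by (auto intro: mem_intros)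
  qed
qed

end

text \<open>Leading coefficients may vanish, so quadratics, and with them square roots, are
  included.\<close>

locale cubic_closed_subfield = real_subfield +
  assumes cubic_root_mem: "a \<in> K \<Longrightarrow> b \<in> K \<Longrightarrow> c \<in> K \<Longrightarrow> d \<in> K \<Longrightarrow> (a, b, c, d) \<noteq> (0, 0, 0, 0) \<Longrightarrow>
    a * x ^ 3 + b * x\<^sup>2 + c * x + d = 0 \<Longrightarrow> x \<in> K"
begin

lemma quadratic_root_mem:
  assumes "b \<in> K" "c \<in> K" "x\<^sup>2 + b * x + c = 0"
  shows "x \<in> K"
  using cubic_root_mem[of 0 1 b c x] assms mem_intros by simp

text \<open>Ferrari's method: the resolvent cubic has a positive root \<open>z\<close>, and \<open>u = sqrt z\<close> splits
  the depressed quartic into two quadratics.\<close>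

lemma depressed_quartic_root_mem:
  assumes K: "p \<in> K" "q \<in> K" "r \<in> K" and x: "x ^ 4 + p * x\<^sup>2 + q * x + r = 0"
  shows "x \<in> K"
proof (cases "q = 0")
  case True
  have "(x\<^sup>2)\<^sup>2 + p * x\<^sup>2 + r = 0"
    using x True by (simp add: power_mult [symmetric])
  then have "x\<^sup>2 \<in> K"
    using K quadratic_root_mem by blast
  then show ?thesis
    using quadratic_root_mem[of 0 "- (x\<^sup>2)" x] by (simp add: mem_intros)
next
  case False
  \<comment> \<open>A factorization \<open>(x^2 + u * x + v) * (x^2 - u * x + w)\<close> forces
    \<open>v + w = p + z\<close>, \<open>w - v = q / u\<close> and \<open>v * w = r\<close> with
    \<open>z = u^2\<close>; eliminating \<open>v\<close> and \<open>w\<close> leaves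
    \<open>g z = 0\<close>.\<close>
  define g where "g z = z ^ 3 + 2 * p * z\<^sup>2 + (p\<^sup>2 - 4 * r) * z - q\<^sup>2" for z
  \<comment> \<open>One plus the absolute values of the lower coefficients of \<open>g\<close>: the
    cube of \<open>N\<close> dominates, so \<open>g N\<close> is nonnegative while
    \<open>g 0\<close> is not positive.\<close>
  define N where "N = 1 + 2 * \<bar>p\<bar> + \<bar>p\<^sup>2 - 4 * r\<bar> + q\<^sup>2"
  have N1: "N \<ge> 1"
    by (simp add: N_def)
  have N2: "N * N \<ge> N"
    using mult_left_mono[OF N1, of N] N1 by simp
  note N = N1 N2 order_trans[OF N1 N2]
  have "N * (N * N) = N * N + 2 * \<bar>p\<bar> * (N * N) + \<bar>p\<^sup>2 - 4 * r\<bar> * (N * N) + q\<^sup>2 * (N * N)"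
    by (subst (1) N_def) (simp add: algebra_simps)
  moreover have "\<bar>p\<^sup>2 - 4 * r\<bar> * (N * N) \<ge> \<bar>p\<^sup>2 - 4 * r\<bar> * N"
    using N by (intro mult_left_mono) auto
  moreover have "\<bar>p\<^sup>2 - 4 * r\<bar> * N \<ge> - (p\<^sup>2 - 4 * r) * N"
    using N by (intro mult_right_mono) auto
  moreover have "2 * \<bar>p\<bar> * (N * N) \<ge> - (2 * p) * (N * N)"
    using N by (intro mult_right_mono) auto
  moreover have "q\<^sup>2 * (N * N) \<ge> q\<^sup>2 * 1"
    using N by (intro mult_left_mono) auto
  moreover have "g N = N * (N * N) - (- (2 * p) * (N * N)) - (- (p\<^sup>2 - 4 * r) * N) - q\<^sup>2 * 1"
    by (simp add: g_def power3_eq_cube power2_eq_square[of N] left_diff_distrib)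
  ultimately have "g N \<ge> 0"
    using N by linarith
  moreover have "g 0 \<le> 0"
    by (simp add: g_def)
  moreover have "continuous_on {0..N} g"
    unfolding g_def by (intro continuous_intros)
  ultimately obtain z where z: "0 \<le> z" "g z = 0"
    using IVT'[of g 0 0 N] N by auto
  then have z0: "z > 0"
    using False by (cases "z = 0") (auto simp: g_def)
  have "z \<in> K"
    using cubic_root_mem[of 1 "2 * p" "p\<^sup>2 - 4 * r" "- q\<^sup>2" z] z K by (simp add: g_def mem_intros)
  define u where "u = sqrt z"
  have u: "u\<^sup>2 = z" "u \<noteq> 0"
    using z0 by (auto simp: u_def)
  have uK: "u \<in> K"
    using quadratic_root_mem[of 0 "- z" u] \<open>z \<in> K\<close> u by (simp add: mem_intros)
  define v where "v = (p + z - q / u) / 2"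
  define w where "w = (p + z + q / u) / 2"
  have vwK: "v \<in> K" "w \<in> K"
    unfolding v_def w_def using K uK \<open>z \<in> K\<close> by (auto intro!: mem_intros)
  define t where "t = q / u"
  have t: "q = t * u"
    using u by (simp add: t_def)
  have vw: "v + w = p + z" "w - v = t" "4 * (v * w) = (p + z)\<^sup>2 - t\<^sup>2"
    by (simp_all add: v_def w_def t_def[symmetric] field_simps power2_eq_square)
  have "z * (4 * (v * w) - 4 * r) = 0"
    using z(2) unfolding vw(3) g_def t power_mult_distrib u(1)
    by (simp add: power2_eq_square power3_eq_cube algebra_simps)
  then have "v * w = r"
    using z0 by simp
  moreover have "(x\<^sup>2 + u * x + v) * (x\<^sup>2 - u * x + w) =
      x ^ 4 + (v + w - u\<^sup>2) * x\<^sup>2 + (w - v) * u * x + v * w"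
    by (simp add: algebra_simps power2_eq_square power4_eq_xxxx)
  ultimately have "(x\<^sup>2 + u * x + v) * (x\<^sup>2 - u * x + w) = 0"
    using x by (simp add: vw u(1) t)
  then have "x\<^sup>2 + u * x + v = 0 \<or> x\<^sup>2 + (- u) * x + w = 0"
    by simp
  then show ?thesis
    using quadratic_root_mem vwK uK uminus_mem by blast
qed

lemma quartic_root_mem:
  assumes K: "a \<in> K" "b \<in> K" "c \<in> K" "d \<in> K" "e \<in> K"
    and nz: "(a, b, c, d, e) \<noteq> (0, 0, 0, 0, 0)"
    and x: "a * x ^ 4 + b * x ^ 3 + c * x\<^sup>2 + d * x + e = 0"
  shows "x \<in> K"
proof (cases "a = 0")
  case True
  then show ?thesis
    using cubic_root_mem[of b c d e x] assms by simp
next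
  case False
  \<comment> \<open>The shift by \<open>B\<close> removes the cubic term.\<close>
  define B C D E where "B = b / a / 4" and "C = c / a" and "D = d / a" and "E = e / a"
  have mem: "B \<in> K" "C \<in> K" "D \<in> K" "E \<in> K"
    using K by (auto simp: B_def C_def D_def E_def intro: mem_intros)
  have "x ^ 4 + 4 * B * x ^ 3 + C * x\<^sup>2 + D * x + E = 0"
  proof -
    have "b = a * (4 * B)" "c = a * C" "d = a * D" "e = a * E"
      using False by (simp_all add: B_def C_def D_def E_def)
    then have "a * (x ^ 4 + 4 * B * x ^ 3 + C * x\<^sup>2 + D * x + E) = 0"
      using x by (simp add: algebra_simps)
    then show ?thesis using False by simp
  qed
  then have "(x + B) ^ 4 + (C - 6 * B\<^sup>2) * (x + B)\<^sup>2 + (D + 8 * B ^ 3 - 2 * B * C) * (x + B)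
      + (E - B * D + B\<^sup>2 * C - 3 * B ^ 4) = 0"
    by Groebner_Basis.algebra
  then have "x + B \<in> K"
    by (rule depressed_quartic_root_mem[rotated -1]) (use mem in \<open>auto intro!: mem_intros\<close>)
  then show ?thesis
    using diff_mem[of "x + B" B] mem by simp
qed

end

section \<open>Lines in coordinates\<close>

definition line_eqn :: "real \<Rightarrow> real \<Rightarrow> real \<Rightarrow> point set" where
  "line_eqn a b c = {(x, y). a * x + b * y = c}"

lemma mem_line_eqn [simp]: "(x, y) \<in> line_eqn a b c \<longleftrightarrow> a * x + b * y = c"
  by (simp add: line_eqn_def)

lemma line_eqn_scale:
  assumes "k \<noteq> 0"
  shows "line_eqn (k * a) (k * b) (k * c) = line_eqn a b c"
proof -
  have "k * a * x + k * b * y = k * c \<longleftrightarrow> a * x + b * y = c" for x y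
  proof -
    have "k * a * x + k * b * y = k * (a * x + b * y)"
      by (simp add: algebra_simps)
    then show ?thesis using assms by simp
  qed
  then show ?thesis by (simp add: line_eqn_def)
qed

lemma line_eqn_eqI:
  assumes "(a, b) \<noteq> (0, 0)" "(a', b') \<noteq> (0, 0)" "a * b' = a' * b"
    and "(x, y) \<in> line_eqn a b c" "(x, y) \<in> line_eqn a' b' c'"
  shows "line_eqn a b c = line_eqn a' b' c'"
proof -
  obtain k where k: "a' = k * a" "b' = k * b"
  proof (cases "a = 0")
    case True
    then have "b \<noteq> 0" "a' = 0" using assms by auto
    then show ?thesis using that[of "b' / b"] True by simp
  next
    case False
    then show ?thesis using that[of "a' / a"] assms by (simp add: field_simps)
  qed
  have "c' = k * (a * x + b * y)"
    using assms(5) k by (simp add: algebra_simps)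
  then have "c' = k * c"
    using assms(4) by simp
  with k show ?thesis
    using line_eqn_scale[of k a b c] assms(2) by auto
qed

lemma line_eqn_cross_nz:
  assumes "(a, b) \<noteq> (0, 0)" "(a', b') \<noteq> (0, 0)" "line_eqn a b c \<noteq> line_eqn a' b' c'"
    and "(x, y) \<in> line_eqn a b c" "(x, y) \<in> line_eqn a' b' c'"
  shows "a * b' - a' * b \<noteq> 0"
  using line_eqn_eqI[of a b a' b' x y c c'] assms by auto

text \<open>Cramer's rule; the explicit coordinates later place intersection points over the field
  of the coefficients.\<close>

lemma line_eqn_Int:
  assumes "a * b' - a' * b \<noteq> 0" "(x, y) \<in> line_eqn a b c" "(x, y) \<in> line_eqn a' b' c'"
  shows "line_eqn a b c \<inter> line_eqn a' b' c' = {(x, y)}"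
    and "line_eqn a b c \<noteq> line_eqn a' b' c'"
    and "x = (c * b' - c' * b) / (a * b' - a' * b)" "y = (a * c' - a' * c) / (a * b' - a' * b)"
proof -
  have *: "x' = (c * b' - c' * b) / (a * b' - a' * b) \<and> y' = (a * c' - a' * c) / (a * b' - a' * b)"
    if "a * x' + b * y' = c" "a' * x' + b' * y' = c'" for x' y'
    using assms(1) that[symmetric] by (simp add: field_simps)
  from * assms(2,3)
  show xy: "x = (c * b' - c' * b) / (a * b' - a' * b)" "y = (a * c' - a' * c) / (a * b' - a' * b)"
    by auto
  show int: "line_eqn a b c \<inter> line_eqn a' b' c' = {(x, y)}"
    using * assms(2,3) xy by auto
  have "(x + b, y - a) \<in> line_eqn a b c"
    using assms(2) by (simp add: algebra_simps)
  moreover have "(x + b, y - a) \<noteq> (x, y)"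
    using assms(1) by auto
  ultimately show "line_eqn a b c \<noteq> line_eqn a' b' c'"
    using int by (metis Int_absorb singletonD)
qed

lemma line_through_eqn:
  assumes "A \<noteq> B"
  shows "line_through A B = line_eqn (snd B - snd A) (fst A - fst B)
     ((snd B - snd A) * fst A + (fst A - fst B) * snd A)"
proof -
  obtain a1 a2 b1 b2 where A: "A = (a1, a2)" and B: "B = (b1, b2)"
    by (metis surj_pair)
  have "(\<exists>u. (x, y) = A + u *\<^sub>R (B - A)) \<longleftrightarrow>
      (b2 - a2) * x + (a1 - b1) * y = (b2 - a2) * a1 + (a1 - b1) * a2" for x y
  proof
    assume "\<exists>u. (x, y) = A + u *\<^sub>R (B - A)"
    then show "(b2 - a2) * x + (a1 - b1) * y = (b2 - a2) * a1 + (a1 - b1) * a2"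
      by (clarsimp simp: A B) (simp add: algebra_simps)
  next
    assume *: "(b2 - a2) * x + (a1 - b1) * y = (b2 - a2) * a1 + (a1 - b1) * a2"
    show "\<exists>u. (x, y) = A + u *\<^sub>R (B - A)"
    proof (cases "b1 = a1")
      case True
      then have "b2 \<noteq> a2" using assms A B by simp
      with * True show ?thesis
        by (intro exI[of _ "(y - a2) / (b2 - a2)"]) (auto simp: A B)
    next
      case False
      with * show ?thesis
        by (intro exI[of _ "(x - a1) / (b1 - a1)"]) (auto simp: A B field_simps)
    qed
  qed
  then show ?thesis
    unfolding line_through_def affine_hull_2_alt by (auto simp: A B line_eqn_def image_iff)
qed

lemma is_line_iff_line_eqn: "is_line t \<longleftrightarrow> (\<exists>a b c. (a, b) \<noteq> (0, 0) \<and> t = line_eqn a b c)"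
proof
  assume "is_line t"
  then obtain A B where "A \<noteq> B" "t = line_through A B"
    by (auto simp: is_line_def)
  then show "\<exists>a b c. (a, b) \<noteq> (0, 0) \<and> t = line_eqn a b c"
    using line_through_eqn[of A B]
    by (metis Pair_inject eq_iff_diff_eq_0 prod.collapse)
next
  assume "\<exists>a b c. (a, b) \<noteq> (0, 0) \<and> t = line_eqn a b c"
  then obtain a b c where ab: "(a, b) \<noteq> (0, 0)" and t: "t = line_eqn a b c"
    by blast
  \<comment> \<open>The foot of the perpendicular from the origin; the direction
    \<open>(- b, a)\<close> leads to a second point.\<close>
  define x where "x = a * c / (a\<^sup>2 + b\<^sup>2)"
  define y where "y = b * c / (a\<^sup>2 + b\<^sup>2)"
  have N: "a\<^sup>2 + b\<^sup>2 \<noteq> 0"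
    using ab by (auto simp: sum_power2_eq_zero_iff)
  have "a * x + b * y = c * (a\<^sup>2 + b\<^sup>2) / (a\<^sup>2 + b\<^sup>2)"
    by (simp add: x_def y_def power2_eq_square algebra_simps flip: add_divide_distrib)
  then have xy: "a * x + b * y = c"
    using N by (metis nonzero_mult_div_cancel_right)
  have "(x, y) \<noteq> (x - b, y + a)"
    using ab by auto
  then show "is_line t"
    unfolding is_line_def t
    by (intro exI[of _ "(x, y)"] exI[of _ "(x - b, y + a)"])
       (auto simp: line_through_eqn simp flip: xy)
qed

lemma line_through_eqnI:
  assumes "A \<noteq> B" "(a, b) \<noteq> (0, 0)" "A \<in> line_eqn a b c" "B \<in> line_eqn a b c"
  shows "line_through A B = line_eqn a b c"
proof -
  obtain a1 a2 b1 b2 where A: "A = (a1, a2)" and B: "B = (b1, b2)"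
    by (metis surj_pair)
  have "a * (b1 - a1) + b * (b2 - a2) = 0"
    using assms(3,4) by (simp add: A B algebra_simps)
  then show ?thesis
    unfolding line_through_eqn[OF assms(1)] using assms
    by (intro line_eqn_eqI[where x = a1 and y = a2]) (auto simp: A B algebra_simps)
qed

lemma affine_parallel_line_eqn_iff:
  assumes "(a, b) \<noteq> (0, 0)" "(a', b') \<noteq> (0, 0)"
  shows "affine_parallel (line_eqn a b c) (line_eqn a' b' c') \<longleftrightarrow> a * b' - a' * b = 0"
proof
  obtain x y where xy: "a * x + b * y = c"
  proof (cases "a = 0")
    case True then show ?thesis using that[of 0 "c / b"] assms by auto
  next
    case False then show ?thesis using that[of "c / a" 0] by auto
  qed
  assume "affine_parallel (line_eqn a b c) (line_eqn a' b' c')"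
  then obtain v where v: "line_eqn a' b' c' = (\<lambda>z. v + z) ` line_eqn a b c"
    by (auto simp: affine_parallel_def)
  obtain v1 v2 where [simp]: "v = (v1, v2)"
    by (metis surj_pair)
  have "v + (x, y) \<in> line_eqn a' b' c'" "v + (x - b, y + a) \<in> line_eqn a' b' c'"
    unfolding v using xy by (intro imageI; simp add: algebra_simps)+
  then show "a * b' - a' * b = 0"
    by (simp add: algebra_simps)
next
  assume cr: "a * b' - a' * b = 0"
  obtain x y where xy: "a * x + b * y = c"
  proof (cases "a = 0")
    case True then show ?thesis using that[of 0 "c / b"] assms by auto
  next
    case False then show ?thesis using that[of "c / a" 0] by auto
  qed
  obtain x' y' where xy': "a' * x' + b' * y' = c'"
  proof (cases "a' = 0")
    case True then show ?thesis using that[of 0 "c' / b'"] assms by auto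
  next
    case False then show ?thesis using that[of "c' / a'" 0] by auto
  qed
  have "line_eqn a' b' c' = line_eqn a b (a * x' + b * y')"
    using assms cr xy' by (intro line_eqn_eqI[of _ _ _ _ x' y']) auto
  moreover have "P \<in> line_eqn a b c \<longleftrightarrow> (x' - x, y' - y) + P \<in> line_eqn a b (a * x' + b * y')" for P
    using xy by (cases P) (auto simp: algebra_simps)
  ultimately show "affine_parallel (line_eqn a b c) (line_eqn a' b' c')"
    unfolding affine_parallel_def using affine_parallel_expl_aux by metis
qed

lemma perpendicular_line_eqn:
  assumes "(a, b) \<noteq> (0, 0)" "(a', b') \<noteq> (0, 0)" "a * a' + b * b' = 0"
  shows "perpendicular (line_eqn a b c) (line_eqn a' b' c')"
proof -
  have N: "a\<^sup>2 + b\<^sup>2 \<noteq> 0" "a'\<^sup>2 + b'\<^sup>2 \<noteq> 0"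
    using assms by (auto simp: sum_power2_eq_zero_iff)
  have *: "p1 * q1 + p2 * q2 = 0" if "a * p1 + b * p2 = 0" "a' * q1 + b' * q2 = 0" for p1 p2 q1 q2
  proof -
    \<comment> \<open>Up to the factors \<open>a^2 + b^2\<close> and \<open>a'^2 + b'^2\<close>, the
      two vectors are \<open>g\<close> and \<open>h\<close> times the directions
      \<open>(- b, a)\<close> and \<open>(- b', a')\<close>.\<close>
    define g h where "g = a * p2 - b * p1" and "h = a' * q2 - b' * q1"
    have "p1 * (a\<^sup>2 + b\<^sup>2) = - b * g" "p2 * (a\<^sup>2 + b\<^sup>2) = a * g"
      "q1 * (a'\<^sup>2 + b'\<^sup>2) = - b' * h" "q2 * (a'\<^sup>2 + b'\<^sup>2) = a' * h"
      unfolding g_def h_def using that by Groebner_Basis.algebra+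
    then have "(a\<^sup>2 + b\<^sup>2) * (a'\<^sup>2 + b'\<^sup>2) * (p1 * q1 + p2 * q2) = g * h * (a * a' + b * b')"
      by Groebner_Basis.algebra
    then have "(a\<^sup>2 + b\<^sup>2) * (a'\<^sup>2 + b'\<^sup>2) * (p1 * q1 + p2 * q2) = 0"
      using assms(3) by simp
    then show ?thesis using N by (metis mult_eq_0_iff)
  qed
  have orth: "(b1 - a1) * (d1 - c1) + (b2 - a2) * (d2 - c2) = 0"
    if "a * a1 + b * a2 = c" "a * b1 + b * b2 = c" "a' * c1 + b' * c2 = c'" "a' * d1 + b' * d2 = c'"
    for a1 a2 b1 b2 c1 c2 d1 d2
    by (rule *) (use that in \<open>simp_all add: algebra_simps\<close>)
  show ?thesis
    unfolding perpendicular_def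
  proof (intro ballI)
    fix A B C D
    assume "A \<in> line_eqn a b c" "B \<in> line_eqn a b c" "C \<in> line_eqn a' b' c'" "D \<in> line_eqn a' b' c'"
    then have "(fst B - fst A) * (fst D - fst C) + (snd B - snd A) * (snd D - snd C) = 0"
      by - (rule orth; simp add: line_eqn_def case_prod_beta)
    then show "orthogonal (B - A) (D - C)"
      by (simp add: orthogonal_def inner_prod_def)
  qed
qed

lemma reflect_in_line_eqn:
  assumes "(u, v) \<noteq> (0, 0)"
  shows "reflect_in (line_eqn u v w) (x, y) =
    (x - 2 * ((u * x + v * y - w) / (u\<^sup>2 + v\<^sup>2)) * u, y - 2 * ((u * x + v * y - w) / (u\<^sup>2 + v\<^sup>2)) * v)"
proof -
  define k where "k = (u * x + v * y - w) / (u\<^sup>2 + v\<^sup>2)"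
  have N: "u\<^sup>2 + v\<^sup>2 \<noteq> 0"
    using assms by (auto simp: sum_power2_eq_zero_iff)
  have kN: "k * (u\<^sup>2 + v\<^sup>2) = u * x + v * y - w"
    using N by (simp add: k_def)
  have eq: "line_eqn u v w = {z. (u, v) \<bullet> z = w}"
    by (auto simp: line_eqn_def)
  have "(x - k * u, y - k * v) = closest_point (line_eqn u v w) (x, y)"
  proof (rule closest_point_unique)
    show "convex (line_eqn u v w)" "closed (line_eqn u v w)"
      unfolding eq by (rule convex_hyperplane closed_hyperplane)+
    show mem: "(x - k * u, y - k * v) \<in> line_eqn u v w"
      using kN by (simp add: algebra_simps power2_eq_square)
    show "\<forall>z\<in>line_eqn u v w. dist (x, y) (x - k * u, y - k * v) \<le> dist (x, y) z"
    proof
      fix z assume z: "z \<in> line_eqn u v w"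
      obtain z1 z2 where [simp]: "z = (z1, z2)" by (metis surj_pair)
      have "k * (u * (x - k * u - z1) + v * (y - k * v - z2)) = 0"
        using z mem by (simp add: algebra_simps)
      moreover have "(x - z1)\<^sup>2 + (y - z2)\<^sup>2 =
          (k * u)\<^sup>2 + (k * v)\<^sup>2 + (x - k * u - z1)\<^sup>2 + (y - k * v - z2)\<^sup>2
          + 2 * (k * (u * (x - k * u - z1) + v * (y - k * v - z2)))"
        by (simp add: power2_eq_square algebra_simps)
      ultimately have "(k * u)\<^sup>2 + (k * v)\<^sup>2 + (x - k * u - z1)\<^sup>2 + (y - k * v - z2)\<^sup>2
          = (x - z1)\<^sup>2 + (y - z2)\<^sup>2"
        by simp
      then have "(k * u)\<^sup>2 + (k * v)\<^sup>2 \<le> (x - z1)\<^sup>2 + (y - z2)\<^sup>2"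
        by (smt (verit) zero_le_power2)
      then show "dist (x, y) (x - k * u, y - k * v) \<le> dist (x, y) z"
        by (simp add: dist_Pair_Pair dist_real_def)
    qed
  qed
  from this[symmetric] show ?thesis
    unfolding reflect_in_def k_def[symmetric] by simp
qed

text \<open>Clearing the denominator makes a fold condition polynomial, both for realizing creases
  and for placing their coefficients in \<open>K\<close>.\<close>

lemma reflect_in_line_eqn_mem_iff:
  assumes "(u, v) \<noteq> (0, 0)"
  shows "reflect_in (line_eqn u v w) (x, y) \<in> line_eqn a b c \<longleftrightarrow>
    (a * x + b * y - c) * (u\<^sup>2 + v\<^sup>2) = 2 * (u * x + v * y - w) * (a * u + b * v)"
proof -
  have N: "u\<^sup>2 + v\<^sup>2 \<noteq> 0"
    using assms by (auto simp: sum_power2_eq_zero_iff)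
  define k where "k = (u * x + v * y - w) / (u\<^sup>2 + v\<^sup>2)"
  have "u * x + v * y - w = k * (u\<^sup>2 + v\<^sup>2)"
    using N by (simp add: k_def)
  then have *: "2 * (u * x + v * y - w) * (a * u + b * v) = (2 * k * (a * u + b * v)) * (u\<^sup>2 + v\<^sup>2)"
    by (simp add: algebra_simps)
  show ?thesis
    unfolding reflect_in_line_eqn[OF assms] k_def[symmetric] * mult_cancel_right using N
    by (auto simp: algebra_simps)
qed

section \<open>Objects reached by construction sequences\<close>

text \<open>Abstracts from lines versus points, so that closure and induction are proved once for
  folds and markings.\<close>

definition construction :: "('a set \<Rightarrow> 'a \<Rightarrow> bool) \<Rightarrow> 'a list \<Rightarrow> bool" where
  "construction step xs \<longleftrightarrow> (\<forall>i < length xs. step (set (take i xs)) (xs ! i))"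

definition constructible :: "('a set \<Rightarrow> 'a \<Rightarrow> bool) \<Rightarrow> 'a \<Rightarrow> bool" where
  "constructible step x \<longleftrightarrow> (\<exists>xs. xs \<noteq> [] \<and> construction step xs \<and> last xs = x)"

lemma construction_snoc:
  "construction step (xs @ [x]) \<longleftrightarrow> construction step xs \<and> step (set xs) x"
  by (auto simp: construction_def nth_append less_Suc_eq)

lemma construction_append:
  assumes mono: "\<And>S S' x. step S x \<Longrightarrow> S \<subseteq> S' \<Longrightarrow> step S' x"
    and "construction step xs" "construction step ys"
  shows "construction step (xs @ ys)"
  using assms(3)
proof (induction ys rule: rev_induct)
  case (snoc y ys)
  then show ?case
    using mono[of "set ys" y "set (xs @ ys)"]
    unfolding append_assoc[symmetric] by (auto simp only: construction_snoc set_append)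
qed (use assms(2) in simp)

text \<open>A monotone step survives a longer prefix, so sequences for the finitely many elements of
  \<open>S\<close> can be concatenated before \<open>x\<close> is appended.\<close>

lemma constructible_step:
  assumes mono: "\<And>S S' x. step S x \<Longrightarrow> S \<subseteq> S' \<Longrightarrow> step S' x"
    and "finite S" "\<And>y. y \<in> S \<Longrightarrow> constructible step y" "step S x"
  shows "constructible step x"
proof -
  have "\<exists>xs. construction step xs \<and> S \<subseteq> set xs"
    using assms(2,3)
  proof (induction S rule: finite_induct)
    case empty
    show ?case by (auto simp: construction_def intro: exI[of _ "[]"])
  next
    case (insert y S)
    from insert obtain xs where xs: "construction step xs" "S \<subseteq> set xs"
      by auto
    from insert.prems[of y] obtain ys where ys: "ys \<noteq> []" "construction step ys" "last ys = y"
      by (auto simp: constructible_def)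
    show ?case
      using construction_append[OF mono xs(1) ys(2)] xs(2) ys last_in_set[of ys]
      by (intro exI[of _ "xs @ ys"]) auto
  qed
  then obtain xs where "construction step xs" "S \<subseteq> set xs"
    by blast
  then have "construction step (xs @ [x])"
    using mono assms(4) by (auto simp: construction_snoc)
  then show ?thesis
    unfolding constructible_def by (intro exI[of _ "xs @ [x]"]) auto
qed

lemma constructible_induct:
  assumes "constructible step x"
    and step: "\<And>S x. (\<And>y. y \<in> S \<Longrightarrow> I y) \<Longrightarrow> step S x \<Longrightarrow> I x"
  shows "I x"
proof -
  have "\<forall>x\<in>set xs. I x" if "construction step xs" for xs
    using that
  proof (induction xs rule: rev_induct)
    case (snoc x xs)
    then show ?case
      using step[of "set xs" x] by (auto simp: construction_snoc)
  qed simp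
  then show ?thesis
    using assms(1) last_in_set by (fastforce simp: constructible_def)
qed

lemma intersection_point_mono:
  "intersection_point T P \<Longrightarrow> T \<subseteq> T' \<Longrightarrow> intersection_point T' P"
  unfolding intersection_point_def by blast

section \<open>Origami constructions\<close>

definition origami_step :: "point set set \<Rightarrow> point set \<Rightarrow> bool" where
  "origami_step T t \<longleftrightarrow> t \<in> origami_start \<or> origami_fold T t"

lemma origami_line_iff: "origami_line t \<longleftrightarrow> constructible origami_step t"
  by (simp add: origami_line_def origami_sequence_def constructible_def construction_def origami_step_def)

lemma origami_fold_mono: "origami_fold T t \<Longrightarrow> T \<subseteq> T' \<Longrightarrow> origami_fold T' t"
  unfolding origami_fold_def using intersection_point_mono by (meson subsetD)

lemma origami_step_mono: "origami_step T t \<Longrightarrow> T \<subseteq> T' \<Longrightarrow> origami_step T' t"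
  unfolding origami_step_def using origami_fold_mono by blast

lemma origami_line_start:
  "origami_line (line_eqn 1 0 0)" "origami_line (line_eqn 0 1 0)" "origami_line (line_eqn 1 1 1)"
proof -
  have "origami_line t" if "t \<in> origami_start" for t
    unfolding origami_line_iff
    by (rule constructible_step[where step = origami_step and S = "{}", OF origami_step_mono]) (use that in \<open>auto simp: origami_step_def\<close>)
  then show "origami_line (line_eqn 1 0 0)" "origami_line (line_eqn 0 1 0)" "origami_line (line_eqn 1 1 1)"
    by (simp_all add: origami_start_def line_eqn_def)
qed

lemma origami_foldI:
  assumes "is_line t" "p \<in> T" "q \<in> T" "\<not> affine_parallel p q" "P \<noteq> Q"
    and "intersection_point T P" "intersection_point T Q"
    and "q = line_through P Q \<or> perpendicular p q" "reflect_in t P \<in> p" "reflect_in t Q \<in> q"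
  shows "origami_fold T t"
  unfolding origami_fold_def using assms by blast

lemma origami_line_fold:
  assumes "origami_fold {t. origami_line t} t"
  shows "origami_line t"
proof -
  let ?T = "{t. origami_line t}"
  from assms obtain p q P Q where "p \<in> ?T" "q \<in> ?T" and par: "\<not> affine_parallel p q"
    and t: "is_line t" and "P \<noteq> Q" and PQ: "intersection_point ?T P" "intersection_point ?T Q"
    and fold: "q = line_through P Q \<or> perpendicular p q" "reflect_in t P \<in> p" "reflect_in t Q \<in> q"
    unfolding origami_fold_def by (elim conjE bexE exE) (rule that)
  then have pq: "origami_line p" "origami_line q"
    by simp_all
  from PQ(1) obtain l l' where l: "origami_line l" "origami_line l'" "l \<noteq> l'" "l \<inter> l' = {P}"
    unfolding intersection_point_def by blast
  from PQ(2) obtain m m' where m: "origami_line m" "origami_line m'" "m \<noteq> m'" "m \<inter> m' = {Q}"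
    unfolding intersection_point_def by blast
  \<comment> \<open>Finitely many lines suffice for the fold: its two target lines and two lines
    through each of its two points.\<close>
  let ?S = "{p, q, l, l', m, m'}"
  have int: "intersection_point ?S P" "intersection_point ?S Q"
    using l m unfolding intersection_point_def by blast+
  have "origami_fold ?S t"
    by (rule origami_foldI[OF t _ _ par \<open>P \<noteq> Q\<close> int fold]) blast+
  then have step: "origami_step ?S t"
    by (simp add: origami_step_def)
  show ?thesis
    unfolding origami_line_iff
    by (rule constructible_step[where step = origami_step, OF origami_step_mono _ _ step])
       (use pq l m in \<open>auto simp: origami_line_iff\<close>)
qed

lemma origami_line_is_line: "origami_line t \<Longrightarrow> is_line t"
  unfolding origami_line_iff
proof (erule constructible_induct)
  fix S t assume "origami_step S t"
  moreover have "is_line {(x, y). x = 0}" "is_line {(x, y). y = 0}" "is_line {(x, y). x + y = 1}"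
    unfolding is_line_iff_line_eqn line_eqn_def
    by (force intro: exI[of _ 1] exI[of _ 0])+
  ultimately show "is_line t"
    unfolding origami_step_def origami_start_def origami_fold_def by blast
qed

lemma origami_pointI:
  assumes "origami_line (line_eqn a b c)" "origami_line (line_eqn a' b' c')"
    and "a * b' - a' * b \<noteq> 0" "a * x + b * y = c" "a' * x + b' * y = c'"
  shows "origami_point (x, y)"
  unfolding origami_point_def intersection_point_def
  using line_eqn_Int(1,2)[OF assms(3), of x y c c'] assms by auto

lemma origami_line_fold_eqn:
  assumes pq: "origami_line (line_eqn a b c)" "origami_line (line_eqn a' b' c')" "a * b' - a' * b \<noteq> 0"
    and P: "origami_point (x, y)" and Q: "origami_point (x', y')" "(x, y) \<noteq> (x', y')"
    and pos: "a' * x + b' * y = c' \<and> a' * x' + b' * y' = c' \<or> a * a' + b * b' = 0"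
    and t: "(u, v) \<noteq> (0, 0)"
      "(a * x + b * y - c) * (u\<^sup>2 + v\<^sup>2) = 2 * (u * x + v * y - w) * (a * u + b * v)"
      "(a' * x' + b' * y' - c') * (u\<^sup>2 + v\<^sup>2) = 2 * (u * x' + v * y' - w) * (a' * u + b' * v)"
  shows "origami_line (line_eqn u v w)"
proof (rule origami_line_fold)
  have nz: "(a, b) \<noteq> (0, 0)" "(a', b') \<noteq> (0, 0)"
    using pq(3) by auto
  have pos: "line_eqn a' b' c' = line_through (x, y) (x', y') \<or>
      perpendicular (line_eqn a b c) (line_eqn a' b' c')"
    using pos
  proof
    assume "a' * x + b' * y = c' \<and> a' * x' + b' * y' = c'"
    then show ?thesis
      using line_through_eqnI[OF Q(2) nz(2)] by auto
  next
    assume "a * a' + b * b' = 0"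
    then show ?thesis
      using perpendicular_line_eqn nz by blast
  qed
  have par: "\<not> affine_parallel (line_eqn a b c) (line_eqn a' b' c')"
    using affine_parallel_line_eqn_iff nz pq(3) by blast
  have line: "is_line (line_eqn u v w)"
    using t(1) is_line_iff_line_eqn by blast
  have refl: "reflect_in (line_eqn u v w) (x, y) \<in> line_eqn a b c"
    "reflect_in (line_eqn u v w) (x', y') \<in> line_eqn a' b' c'"
    using reflect_in_line_eqn_mem_iff[OF t(1)] t(2,3) by blast+
  show "origami_fold {t. origami_line t} (line_eqn u v w)"
    using origami_foldI[OF line _ _ par Q(2) _ _ pos refl, of "{t. origami_line t}"] pq P Q(1)
    unfolding origami_point_def by blast
qed

text \<open>Fold the line \<open>q\<close> onto itself with \<open>P\<close> fixed: \<open>P\<close> lies on a second origami line \<open>p\<close>, so the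
  crease takes \<open>P\<close> to \<open>p\<close>.\<close>

lemma origami_line_perpendicular:
  assumes q: "origami_line (line_eqn a b c)"
    and P: "origami_point (x, y)" "a * x + b * y = c"
    and Q: "origami_point (x', y')" "a * x' + b * y' = c" "(x, y) \<noteq> (x', y')"
    and t: "(u, v) \<noteq> (0, 0)" "a * u + b * v = 0" "u * x + v * y = w"
  shows "origami_line (line_eqn u v w)"
proof -
  \<comment> \<open>A degenerate equation satisfied by a point describes the whole plane, which is
    not a line.\<close>
  have nz: "(a, b) \<noteq> (0, 0)"
  proof
    assume "(a, b) = (0, 0)"
    then have "line_eqn a b c = UNIV"
      using P(2) by (auto simp: line_eqn_def)
    then obtain a' b' c' where *: "(a', b') \<noteq> (0, 0)" "line_eqn a' b' c' = UNIV"
      using q origami_line_is_line is_line_iff_line_eqn by metis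
    then have "a' * 0 + b' * 0 = c'" "a' * a' + b' * b' = c'"
      by (metis UNIV_I mem_line_eqn)+
    with * show False
      by (metis add_nonneg_eq_0_iff mult_eq_0_iff mult_zero_right add.right_neutral zero_le_square)
  qed
  from P(1) obtain l where l: "origami_line l" "l \<noteq> line_eqn a b c" "(x, y) \<in> l"
    unfolding origami_point_def intersection_point_def by blast
  then obtain a' b' c' where l': "(a', b') \<noteq> (0, 0)" "l = line_eqn a' b' c'"
    using origami_line_is_line is_line_iff_line_eqn by blast
  then have "a' * b - a * b' \<noteq> 0"
    using line_eqn_cross_nz[of a' b' a b c' c x y] l P(2) nz by auto
  with l(1) q show ?thesis
    unfolding l'(2)
    by (rule origami_line_fold_eqn[OF _ _ _ P(1) Q(1,3)]) (use P Q l l' t in auto)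
qed

section \<open>Arithmetic of the origami numbers\<close>

lemma origami_line_diagonals: "origami_line (line_eqn 1 (- 1) 0)" "origami_line (line_eqn 1 1 0)"
  and origami_point_start: "origami_point (0, 0)" "origami_point (1, 0)" "origami_point (0, 1)"
proof -
  note L = origami_line_start
  show P: "origami_point (0, 0)" "origami_point (1, 0)" "origami_point (0, 1)"
    using origami_pointI[OF L(1,2)] origami_pointI[OF L(2,3)] origami_pointI[OF L(1,3)] by simp_all
  \<comment> \<open>Both bisectors of the axes solve the same fold: they fix the origin and take
    \<open>(1, 0)\<close> to the y-axis.\<close>
  show "origami_line (line_eqn 1 (- 1) 0)" "origami_line (line_eqn 1 1 0)"
    by (rule origami_line_fold_eqn[OF L(1,2) _ P(2,1)]; simp)+
qed

lemma origami_numbers_iff: "x \<in> origami_numbers \<longleftrightarrow> origami_point (x, 0)"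
  by (simp add: origami_numbers_def)

lemma origami_numbers_0_1: "0 \<in> origami_numbers" "1 \<in> origami_numbers"
  using origami_point_start by (simp_all add: origami_numbers_iff)

lemma origami_line_vertical:
  assumes "a \<in> origami_numbers"
  shows "origami_line (line_eqn 1 0 a)"
proof -
  \<comment> \<open>Any point of the x-axis other than \<open>(a, 0)\<close> serves to fold the axis
    onto itself.\<close>
  have Q: "origami_point (if a = 0 then 1 else 0, 0)"
    using origami_point_start by simp
  show ?thesis
    by (rule origami_line_perpendicular[OF origami_line_start(2) assms[unfolded origami_numbers_iff] _ Q])
       (auto split: if_splits)
qed

lemma origami_line_horizontal:
  assumes "a \<in> origami_numbers"
  shows "origami_line (line_eqn 0 1 a)"
proof (cases "a = 0")
  case True
  then show ?thesis using origami_line_start by simp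
next
  case False
  \<comment> \<open>The diagonal carries the abscissa \<open>a\<close> over to a height.\<close>
  have "origami_point (a, a)"
    by (rule origami_pointI[OF origami_line_vertical[OF assms] origami_line_diagonals(1)]) auto
  then show ?thesis
    by (rule origami_line_perpendicular[OF origami_line_vertical[OF assms] _ _ assms[unfolded origami_numbers_iff]])
       (use False in auto)
qed

lemma origami_point_of_numbers:
  "a \<in> origami_numbers \<Longrightarrow> b \<in> origami_numbers \<Longrightarrow> origami_point (a, b)"
  by (rule origami_pointI[OF origami_line_vertical origami_line_horizontal]) auto

lemma origami_number_fst:
  assumes "origami_point (a, b)" "b \<in> origami_numbers"
  shows "a \<in> origami_numbers"
proof -
  have Q: "origami_point (if a = 0 then 1 else 0, b)"
    using origami_point_of_numbers origami_numbers_0_1 assms(2) by simp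
  have "origami_line (line_eqn 1 0 a)"
    by (rule origami_line_perpendicular[OF origami_line_horizontal[OF assms(2)] assms(1) _ Q])
       (auto split: if_splits)
  from origami_pointI[OF this origami_line_start(2)] show ?thesis
    by (simp add: origami_numbers_iff)
qed

lemma origami_numbers_uminus:
  assumes "a \<in> origami_numbers"
  shows "- a \<in> origami_numbers"
  by (rule origami_number_fst[OF _ assms],
      rule origami_pointI[OF origami_line_diagonals(2) origami_line_horizontal[OF assms]]) auto

text \<open>The perpendicular to the diagonal at \<open>(a, a)\<close> meets the x-axis at
  \<open>2 * a\<close>.\<close>

lemma origami_numbers_double:
  assumes "a \<in> origami_numbers"
  shows "2 * a \<in> origami_numbers"
proof (cases "a = 0")
  case True
  then show ?thesis using assms by simp
next
  case False
  have "origami_line (line_eqn 1 1 (2 * a))"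
    by (rule origami_line_perpendicular[OF origami_line_diagonals(1)
          origami_point_of_numbers[OF assms assms] _ origami_point_start(1)])
       (use False in auto)
  from origami_pointI[OF this origami_line_start(2)] show ?thesis
    by (simp add: origami_numbers_iff)
qed

text \<open>Fold the x-axis onto itself so that \<open>(a, 0)\<close> lands on the vertical through
  \<open>b\<close>.\<close>

lemma origami_numbers_midpoint:
  assumes "a \<in> origami_numbers" "b \<in> origami_numbers"
  shows "(a + b) / 2 \<in> origami_numbers"
proof (cases "a = b")
  case True
  then show ?thesis using assms by simp
next
  case False
  have Q: "origami_point (if a = 0 then 1 else 0, 0)"
    using origami_point_start by simp
  have "origami_line (line_eqn 1 0 ((a + b) / 2))"
    by (rule origami_line_fold_eqn[OF origami_line_vertical[OF assms(2)] origami_line_start(2) _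
          assms(1)[unfolded origami_numbers_iff] Q])
       (use False in \<open>auto split: if_splits simp: field_simps\<close>)
  from origami_pointI[OF this origami_line_start(2)] show ?thesis
    by (simp add: origami_numbers_iff)
qed

lemma origami_numbers_add: "a \<in> origami_numbers \<Longrightarrow> b \<in> origami_numbers \<Longrightarrow> a + b \<in> origami_numbers"
  using origami_numbers_double[OF origami_numbers_midpoint[of a b]] by simp

lemma origami_numbers_diff: "a \<in> origami_numbers \<Longrightarrow> b \<in> origami_numbers \<Longrightarrow> a - b \<in> origami_numbers"
  using origami_numbers_add[of a "- b"] origami_numbers_uminus by simp

lemma origami_numbers_half: "a \<in> origami_numbers \<Longrightarrow> a / 2 \<in> origami_numbers"
  using origami_numbers_midpoint[of a 0] origami_numbers_0_1 by simp

section \<open>Cubic equations solved by a fold\<close>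

text \<open>A crease \<open>x + s * y = w\<close> that takes \<open>(0, 0)\<close> to the line \<open>x = - \<alpha>\<close> and \<open>(x', y')\<close> to the line
  \<open>y = y' - \<delta>\<close> has a slope parameter \<open>s\<close> with \<open>\<alpha> s\<^sup>3 + (2 y' - \<delta>) s\<^sup>2 + (2 x' + \<alpha>) s = \<delta>\<close>.\<close>

lemma origami_numbers_fold_cubic:
  assumes mem: "\<alpha> \<in> origami_numbers" "\<beta> \<in> origami_numbers" "\<gamma> \<in> origami_numbers" "\<delta> \<in> origami_numbers"
    and nz: "\<gamma> \<noteq> \<alpha> \<or> \<beta> \<noteq> - \<delta>" and root: "\<alpha> * s ^ 3 + \<beta> * s\<^sup>2 + \<gamma> * s - \<delta> = 0"
  shows "s \<in> origami_numbers"
proof -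
  \<comment> \<open>The solution of the first fold equation, which takes the origin to
    \<open>x = - \<alpha>\<close>.\<close>
  define w where "w = - \<alpha> * (1 + s\<^sup>2) / 2"
  \<comment> \<open>Chosen so that \<open>2 * x' + \<alpha> = \<gamma>\<close> and
    \<open>2 * y' - \<delta> = \<beta>\<close>; both vanish, and the two points coincide, exactly in
    the excluded case.\<close>
  define x' y' where "x' = (\<gamma> - \<alpha>) / 2" and "y' = (\<beta> + \<delta>) / 2"
  have mem': "x' \<in> origami_numbers" "y' \<in> origami_numbers" "y' - \<delta> \<in> origami_numbers" "- \<alpha> \<in> origami_numbers"
    unfolding x'_def y'_def
    by (intro origami_numbers_half origami_numbers_add origami_numbers_diff origami_numbers_uminus mem)+
  have line: "origami_line (line_eqn 1 s w)"
  proof (rule origami_line_fold_eqn[OF origami_line_vertical[OF mem'(4)] origami_line_horizontal[OF mem'(3)]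
        _ origami_point_start(1) origami_point_of_numbers[OF mem'(1,2)]])
    have "2 * (x' + s * y' - w) * s - \<delta> * (1 + s\<^sup>2) = \<alpha> * s ^ 3 + \<beta> * s\<^sup>2 + \<gamma> * s - \<delta>"
      by (simp add: w_def x'_def y'_def power2_eq_square power3_eq_cube field_simps)
    then show "(0 * x' + 1 * y' - (y' - \<delta>)) * (1\<^sup>2 + s\<^sup>2) = 2 * (1 * x' + s * y' - w) * (0 * 1 + 1 * s)"
      using root by simp
    show "(0, 0) \<noteq> (x', y')"
      using nz by (auto simp: x'_def y'_def)
  qed (auto simp: w_def)
  \<comment> \<open>The crease meets the lines of height 0 and 1 at the abscissas \<open>w\<close>
    and \<open>w - s\<close>, whose difference is the root.\<close>
  have "w \<in> origami_numbers"
    using origami_pointI[OF line origami_line_start(2), of w 0] by (simp add: origami_numbers_iff)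
  moreover have "w - s \<in> origami_numbers"
    using origami_number_fst[OF origami_pointI[OF line origami_line_horizontal, of 1 "w - s" 1]]
      origami_numbers_0_1 by simp
  ultimately show ?thesis
    using origami_numbers_diff[of w "w - s"] by simp
qed

text \<open>The cubic is \<open>(b * s - a) * (s^2 + 2)\<close>; the simpler factor
  \<open>s^2 + 1\<close> would run into the excluded case of the fold.\<close>

lemma origami_numbers_divide:
  assumes "a \<in> origami_numbers" "b \<in> origami_numbers" "b \<noteq> 0"
  shows "a / b \<in> origami_numbers"
proof (rule origami_numbers_fold_cubic)
  show "b \<in> origami_numbers" "- a \<in> origami_numbers" "2 * b \<in> origami_numbers" "2 * a \<in> origami_numbers"
    using assms origami_numbers_uminus origami_numbers_double by auto
  show "b * (a / b) ^ 3 + - a * (a / b)\<^sup>2 + 2 * b * (a / b) - 2 * a = 0"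
    using assms(3) by (simp add: field_simps power2_eq_square power3_eq_cube)
  show "2 * b \<noteq> b \<or> - a \<noteq> - (2 * a)"
    using assms(3) by simp
qed

text \<open>The excluded case \<open>\<gamma> = \<alpha>\<close>, \<open>\<beta> = - \<delta>\<close> of the fold is the cubic \<open>(s\<^sup>2 + 1) * (\<alpha> * s - \<delta>)\<close>.\<close>

lemma cubic_closed_origami_numbers: "cubic_closed_subfield origami_numbers"
proof unfold_locales
  fix a b c d x
  assume mem: "a \<in> origami_numbers" "b \<in> origami_numbers" "c \<in> origami_numbers" "d \<in> origami_numbers"
    and nz: "(a, b, c, d) \<noteq> (0, 0, 0, 0)" and root: "a * x ^ 3 + b * x\<^sup>2 + c * x + d = 0"
  show "x \<in> origami_numbers"
  proof (cases "c \<noteq> a \<or> b \<noteq> d")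
    case True
    then show ?thesis
      using origami_numbers_fold_cubic[of a b c "- d" x] origami_numbers_uminus mem root by simp
  next
    case False
    have "x\<^sup>2 + 1 \<noteq> 0"
      by (simp add: add_nonneg_eq_0_iff)
    moreover have "(x\<^sup>2 + 1) * (a * x + d) = 0"
      using root False by (simp add: algebra_simps power2_eq_square power3_eq_cube)
    ultimately have "a * x + d = 0" by simp
    moreover from this have "a \<noteq> 0"
      using nz False by auto
    ultimately have "x = - d / a"
      by (simp add: field_simps eq_neg_iff_add_eq_0)
    then show ?thesis
      using origami_numbers_divide mem \<open>a \<noteq> 0\<close> origami_numbers_uminus by simp
  qed
qed (fact origami_numbers_0_1 origami_numbers_diff origami_numbers_divide)+

section \<open>Coordinates of origami points\<close>

context cubic_closed_subfield
begin

definition line_over :: "point set \<Rightarrow> bool" where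
  "line_over t \<longleftrightarrow> (\<exists>a\<in>K. \<exists>b\<in>K. \<exists>c\<in>K. (a, b) \<noteq> (0, 0) \<and> t = line_eqn a b c)"

lemma line_overI: "a \<in> K \<Longrightarrow> b \<in> K \<Longrightarrow> c \<in> K \<Longrightarrow> (a, b) \<noteq> (0, 0) \<Longrightarrow> line_over (line_eqn a b c)"
  unfolding line_over_def by blast

lemma line_over_Int:
  assumes "line_over l" "line_over m" "l \<noteq> m" "P \<in> l" "P \<in> m"
  shows "P \<in> K \<times> K"
proof -
  obtain a b c where K: "a \<in> K" "b \<in> K" "c \<in> K" and nz: "(a, b) \<noteq> (0, 0)" and l: "l = line_eqn a b c"
    using assms(1) unfolding line_over_def by blast
  obtain a' b' c' where K': "a' \<in> K" "b' \<in> K" "c' \<in> K" and nz': "(a', b') \<noteq> (0, 0)"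
    and m: "m = line_eqn a' b' c'"
    using assms(2) unfolding line_over_def by blast
  obtain x y where P: "P = (x, y)"
    by (metis surj_pair)
  have "a * b' - a' * b \<noteq> 0"
    using line_eqn_cross_nz[OF nz nz'] assms(3-5) unfolding l m P by blast
  from line_eqn_Int(3,4)[OF this] have
    "x = (c * b' - c' * b) / (a * b' - a' * b)" "y = (a * c' - a' * c) / (a * b' - a' * b)"
    using assms(4,5) unfolding l m P by blast+
  then show ?thesis
    using K K' unfolding P by (simp add: mem_intros)
qed

lemma fold_line_over:
  assumes p: "line_over p" and q: "line_over q" and par: "\<not> affine_parallel p q"
    and PQ: "P \<in> K \<times> K" "Q \<in> K \<times> K" "P \<noteq> Q"
    and t: "is_line t" "reflect_in t P \<in> p" "reflect_in t Q \<in> q"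
  shows "line_over t"
proof -
  obtain a b c where K: "a \<in> K" "b \<in> K" "c \<in> K" and nz: "(a, b) \<noteq> (0, 0)" and p_eq: "p = line_eqn a b c"
    using p unfolding line_over_def by blast
  obtain a' b' c' where K': "a' \<in> K" "b' \<in> K" "c' \<in> K" and nz': "(a', b') \<noteq> (0, 0)" and q_eq: "q = line_eqn a' b' c'"
    using q unfolding line_over_def by blast
  have cross: "a * b' - a' * b \<noteq> 0"
    using par affine_parallel_line_eqn_iff[OF nz nz'] p_eq q_eq by blast
  obtain x y x' y' where P: "P = (x, y)" and Q: "Q = (x', y')"
    by (metis surj_pair)
  then have xy: "x \<in> K" "y \<in> K" "x' \<in> K" "y' \<in> K" and neq: "x \<noteq> x' \<or> y \<noteq> y'"
    using PQ by auto
  obtain u\<^sub>0 v\<^sub>0 w\<^sub>0 where t0: "(u\<^sub>0, v\<^sub>0) \<noteq> (0, 0)" "t = line_eqn u\<^sub>0 v\<^sub>0 w\<^sub>0"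
    using t(1) is_line_iff_line_eqn by blast
  \<comment> \<open>Normalization leaves one unknown \<open>u\<close> for the direction;
    \<open>v = 0\<close> is the vertical crease.\<close>
  obtain u v w where uv: "v = 1 \<or> v = 0 \<and> u = 1" and t_eq: "t = line_eqn u v w"
  proof (cases "v\<^sub>0 = 0")
    case True
    then show ?thesis
      using that[of 0 1 "w\<^sub>0 / u\<^sub>0"] line_eqn_scale[of "1 / u\<^sub>0" u\<^sub>0 v\<^sub>0 w\<^sub>0] t0 by simp
  next
    case False
    then show ?thesis
      using that[of 1 "u\<^sub>0 / v\<^sub>0" "w\<^sub>0 / v\<^sub>0"] line_eqn_scale[of "1 / v\<^sub>0" u\<^sub>0 v\<^sub>0 w\<^sub>0] t0 by simp
  qed
  then have uv0: "(u, v) \<noteq> (0, 0)" by auto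
  define dp dq where "dp = a * x + b * y - c" and "dq = a' * x' + b' * y' - c'"
  have dK: "dp \<in> K" "dq \<in> K"
    unfolding dp_def dq_def using K K' xy by (auto intro!: mem_intros)
  define N where "N = u\<^sup>2 + v\<^sup>2"
  have eqp: "dp * N = 2 * (u * x + v * y - w) * (a * u + b * v)"
    and eqq: "dq * N = 2 * (u * x' + v * y' - w) * (a' * u + b' * v)"
    using t reflect_in_line_eqn_mem_iff[OF uv0]
    unfolding P Q t_eq p_eq q_eq dp_def dq_def N_def by blast+
  define d1 d2 where "d1 = x - x'" and "d2 = y - y'"
  have D: "d1 \<in> K" "d2 \<in> K" "(d1, d2) \<noteq> (0, 0)"
    unfolding d1_def d2_def using xy neq by (auto intro: mem_intros)
  \<comment> \<open>Cross-multiplying the two fold equations eliminates \<open>w\<close>.\<close>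
  have elim: "dp * (a' * u + b' * v) * N - dq * (a * u + b * v) * N
      - 2 * (u * d1 + v * d2) * (a * u + b * v) * (a' * u + b' * v) = 0"
    using eqp eqq unfolding d1_def d2_def by Groebner_Basis.algebra
  have uK: "u \<in> K"
  proof (cases "v = 1")
    case False
    then show ?thesis using uv mem_intros by simp
  next
    case True
    define E S where "E = a * a' - b * b'" and "S = a * b' + a' * b"
    define c3 c2 c1 c0 where "c3 = dp * a' - dq * a - 2 * d1 * (a * a')"
      and "c2 = dp * b' - dq * b - 2 * (d1 * S + d2 * (a * a'))"
      and "c1 = dp * a' - dq * a - 2 * (d1 * (b * b') + d2 * S)"
      and "c0 = dp * b' - dq * b - 2 * d2 * (b * b')"
    note defs = c3_def c2_def c1_def c0_def S_def
    have cK: "c3 \<in> K" "c2 \<in> K" "c1 \<in> K" "c0 \<in> K"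
      unfolding defs using K K' xy dK D by (auto intro!: mem_intros)
    have "c3 * u ^ 3 + c2 * u\<^sup>2 + c1 * u + c0 = 0"
      using elim unfolding True N_def defs
      by (simp add: algebra_simps power2_eq_square power3_eq_cube)
    moreover have "(c3, c2, c1, c0) \<noteq> (0, 0, 0, 0)"
    proof
      assume "(c3, c2, c1, c0) = (0, 0, 0, 0)"
      \<comment> \<open>These differences are, up to sign, the imaginary and real parts of the cubic
        at the imaginary unit. There \<open>N\<close> vanishes, and a product of three nonzero
        complex numbers remains, built from the vector \<open>(d1, d2)\<close> and the two
        normals.\<close>
      then have "c3 - c1 = 0" "c2 - c0 = 0" by auto
      then have *: "d1 * E = d2 * S" "d1 * S = - d2 * E"
        unfolding E_def defs by (simp_all add: algebra_simps)
      have "(d1\<^sup>2 + d2\<^sup>2) * E = 0" "(d1\<^sup>2 + d2\<^sup>2) * S = 0"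
        using * by Groebner_Basis.algebra+
      moreover have "d1\<^sup>2 + d2\<^sup>2 \<noteq> 0"
        using D(3) by (auto simp: sum_power2_eq_zero_iff)
      ultimately have "E = 0" "S = 0" by (metis mult_eq_0_iff)+
      moreover have "E\<^sup>2 + S\<^sup>2 = (a\<^sup>2 + b\<^sup>2) * (a'\<^sup>2 + b'\<^sup>2)"
        unfolding E_def S_def by (simp add: algebra_simps power2_eq_square)
      ultimately show False
        using nz nz' by (auto simp: sum_power2_eq_zero_iff)
    qed
    ultimately show ?thesis
      using cubic_root_mem cK by blast
  qed
  have vK: "v \<in> K" using uv mem_intros by auto
  have NK: "N \<in> K" unfolding N_def using uK vK by (auto intro!: mem_intros)
  \<comment> \<open>The crease cannot be perpendicular to both of two non-parallel lines, so one of
    the fold equations determines \<open>w\<close>.\<close>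
  have "a * u + b * v \<noteq> 0 \<or> a' * u + b' * v \<noteq> 0"
  proof (rule ccontr)
    assume "\<not> ?thesis"
    then have "(a * b' - a' * b) * u = 0" "(a * b' - a' * b) * v = 0"
      by (simp_all, Groebner_Basis.algebra+)
    then show False using cross uv0 by simp
  qed
  then have "w = u * x + v * y - dp * N / (2 * (a * u + b * v)) \<or>
      w = u * x' + v * y' - dq * N / (2 * (a' * u + b' * v))"
    using eqp eqq by (auto simp: field_simps)
  then have "w \<in> K"
    using uK vK NK dK K K' xy by (elim disjE; (simp only:)?) (auto intro!: mem_intros)
  then show ?thesis
    unfolding t_eq using uK vK uv0 by (intro line_overI)
qed

lemma origami_line_over: "origami_line t \<Longrightarrow> line_over t"
  unfolding origami_line_iff
proof (erule constructible_induct)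
  fix T t assume T: "\<And>l. l \<in> T \<Longrightarrow> line_over l" and "origami_step T t"
  have start: "line_over (line_eqn 1 0 0)" "line_over (line_eqn 0 1 0)" "line_over (line_eqn 1 1 1)"
    by (rule line_overI; simp add: mem_intros)+
  have int: "P \<in> K \<times> K" if "intersection_point T P" for P
    using that line_over_Int T unfolding intersection_point_def by blast
  from \<open>origami_step T t\<close> show "line_over t"
    unfolding origami_step_def
  proof
    assume "t \<in> origami_start"
    then show ?thesis
      using start unfolding origami_start_def line_eqn_def by auto
  next
    assume "origami_fold T t"
    then show ?thesis
      unfolding origami_fold_def using fold_line_over T int by blast
  qed
qed

lemma origami_point_over: "origami_point P \<Longrightarrow> P \<in> K \<times> K"
  using line_over_Int origami_line_over unfolding origami_point_def intersection_point_def by blast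

end

section \<open>Marked ruler constructions\<close>

definition marked_ruler_step :: "point set \<Rightarrow> point \<Rightarrow> bool" where
  "marked_ruler_step S P \<longleftrightarrow>
     P \<in> marked_ruler_start \<or> intersection_point (lines_of S) P \<or> marking_step S P"

lemma marked_ruler_point_iff: "marked_ruler_point P \<longleftrightarrow> constructible marked_ruler_step P"
  by (simp add: marked_ruler_point_def marked_ruler_sequence_def constructible_def construction_def
      marked_ruler_step_def)

lemma lines_ofI: "A \<in> S \<Longrightarrow> B \<in> S \<Longrightarrow> A \<noteq> B \<Longrightarrow> line_through A B \<in> lines_of S"
  unfolding lines_of_def by blast

lemma lines_of_mono: "S \<subseteq> S' \<Longrightarrow> lines_of S \<subseteq> lines_of S'"
  unfolding lines_of_def by blast

lemma marked_ruler_step_mono: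
  assumes "marked_ruler_step S P" "S \<subseteq> S'"
  shows "marked_ruler_step S' P"
proof -
  have "intersection_point (lines_of S') P" if "intersection_point (lines_of S) P"
    using that lines_of_mono[OF assms(2)] by (rule intersection_point_mono)
  moreover have "marking_step S' P" if "marking_step S P"
    using that lines_of_mono[OF assms(2)] assms(2) unfolding marking_step_def by (meson subsetD)
  ultimately show ?thesis
    using assms(1) unfolding marked_ruler_step_def by blast
qed

lemma marked_ruler_point_step:
  assumes "finite S" "\<And>A. A \<in> S \<Longrightarrow> marked_ruler_point A" "marked_ruler_step S P"
  shows "marked_ruler_point P"
  unfolding marked_ruler_point_iff
  by (rule constructible_step[where step = marked_ruler_step, OF marked_ruler_step_mono _ _ assms(3)])
     (use assms in \<open>auto simp: marked_ruler_point_iff\<close>)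

lemma marked_ruler_point_start:
  "marked_ruler_point (0, 0)" "marked_ruler_point (1, 0)" "marked_ruler_point (0, 1)"
  by (rule marked_ruler_point_step[of "{}"]; simp add: marked_ruler_step_def marked_ruler_start_def)+

section \<open>Intersections, unit steps and parallels with the ruler\<close>

definition cross :: "point \<Rightarrow> point \<Rightarrow> real" where
  "cross v w = fst v * snd w - snd v * fst w"

lemma cross_eq_0D:
  assumes "cross v w = 0" "v \<noteq> 0"
  shows "\<exists>t. w = t *\<^sub>R v"
proof -
  obtain v1 v2 w1 w2 where vw: "v = (v1, v2)" "w = (w1, w2)"
    by (metis surj_pair)
  show ?thesis
  proof (cases "v1 = 0")
    case True
    then show ?thesis
      using assms by (intro exI[of _ "w2 / v2"]) (auto simp: vw cross_def zero_prod_def)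
  next
    case False
    then show ?thesis
      using assms by (intro exI[of _ "w1 / v1"]) (auto simp: vw cross_def field_simps)
  qed
qed

lemma mem_line_through_iff: "P \<in> line_through A B \<longleftrightarrow> (\<exists>u. P = A + u *\<^sub>R (B - A))"
  unfolding line_through_def affine_hull_2_alt by auto

lemma line_through_Int:
  assumes P: "P \<in> line_through A B" "P \<in> line_through C D" and cross: "cross (B - A) (D - C) \<noteq> 0"
  shows "line_through A B \<inter> line_through C D = {P}" "line_through A B \<noteq> line_through C D"
proof -
  have neq: "A \<noteq> B" "C \<noteq> D"
    using cross by (auto simp: cross_def)
  have *: "(snd B - snd A) * (fst C - fst D) - (snd D - snd C) * (fst A - fst B) \<noteq> 0"
    using cross by (simp add: cross_def algebra_simps)
  obtain x y where xy: "P = (x, y)"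
    by (metis surj_pair)
  show "line_through A B \<inter> line_through C D = {P}" "line_through A B \<noteq> line_through C D"
    using line_eqn_Int(1,2)[OF *] P unfolding line_through_eqn[OF neq(1)] line_through_eqn[OF neq(2)] xy
    by blast+
qed

lemma marked_ruler_point_Int:
  assumes pts: "marked_ruler_point A" "marked_ruler_point B" "marked_ruler_point C" "marked_ruler_point D"
    and P: "P = A + u *\<^sub>R (B - A)" "P = C + v *\<^sub>R (D - C)" and cross: "cross (B - A) (D - C) \<noteq> 0"
  shows "marked_ruler_point P"
proof (rule marked_ruler_point_step[of "{A, B, C, D}"])
  have "A \<noteq> B" "C \<noteq> D"
    using cross by (auto simp: cross_def)
  then have lines: "line_through A B \<in> lines_of {A, B, C, D}" "line_through C D \<in> lines_of {A, B, C, D}"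
    by (auto intro: lines_ofI)
  have mem: "P \<in> line_through A B" "P \<in> line_through C D"
    using P mem_line_through_iff by blast+
  have "intersection_point (lines_of {A, B, C, D}) P"
    unfolding intersection_point_def
    by (intro bexI[OF _ lines(1)] bexI[OF _ lines(2)] conjI line_through_Int[OF mem cross])
  then show "marked_ruler_step {A, B, C, D} P"
    unfolding marked_ruler_step_def by blast
qed (use pts in auto)

lemma marking_stepI:
  assumes "V \<in> S" "r \<in> lines_of S" "s \<in> lines_of S" "r \<noteq> s" "P \<in> r" "Q \<in> s" "dist P Q = 1"
    and "collinear {V, P, Q}"
  shows "marking_step S P"
  unfolding marking_step_def using assms by blast

lemma marked_ruler_point_mark:
  assumes pts: "marked_ruler_point A" "marked_ruler_point B" "marked_ruler_point C" "marked_ruler_point D"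
      "marked_ruler_point V"
    and neq: "A \<noteq> B" "C \<noteq> D" "line_through A B \<noteq> line_through C D"
    and P: "P \<in> line_through A B" and Q: "Q \<in> line_through C D"
    and mark: "dist P Q = 1" "collinear {V, P, Q}"
  shows "marked_ruler_point P"
proof (rule marked_ruler_point_step[of "{A, B, C, D, V}"])
  have "line_through A B \<in> lines_of {A, B, C, D, V}" "line_through C D \<in> lines_of {A, B, C, D, V}"
    using neq by (auto intro: lines_ofI)
  then have "marking_step {A, B, C, D, V} P"
    by (intro marking_stepI[OF _ _ _ neq(3) P Q mark]) simp_all
  then show "marked_ruler_step {A, B, C, D, V} P"
    unfolding marked_ruler_step_def by blast
qed (use pts in auto)

text \<open>Marking from a point \<open>A\<close>, which is at the same time the second marked point.\<close>

lemma marked_ruler_point_unit: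
  assumes pts: "marked_ruler_point A" "marked_ruler_point B" "marked_ruler_point C"
    and cross: "cross (B - A) (C - A) \<noteq> 0" and s: "\<bar>s\<bar> * norm (B - A) = 1"
  shows "marked_ruler_point (A + s *\<^sub>R (B - A))"
proof (rule marked_ruler_point_mark[of A B A C A _ A])
  have mem: "A \<in> line_through A B" "A \<in> line_through A C"
    unfolding mem_line_through_iff by (rule exI[of _ 0]; simp)+
  then show "line_through A B \<noteq> line_through A C" "A \<in> line_through A C"
    using line_through_Int(2)[OF mem cross] by auto
  show "A \<noteq> B" "A \<noteq> C"
    using cross by (auto simp: cross_def)
  show "A + s *\<^sub>R (B - A) \<in> line_through A B"
    unfolding mem_line_through_iff by blast
  show "dist (A + s *\<^sub>R (B - A)) A = 1"
    using s by (simp add: dist_norm)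
  show "collinear {A, A + s *\<^sub>R (B - A), A}"
    by (simp add: insert_commute)
qed (use pts in auto)

text \<open>The ruler construction of a parallel to a line with three equally spaced points \<open>A\<close>,
  \<open>A + e\<close>, \<open>A + 2 e\<close>.\<close>

lemma marked_ruler_parallel_off_line:
  assumes pts: "marked_ruler_point A" "marked_ruler_point B" "marked_ruler_point P"
    and cross: "cross (B - A) (P - A) \<noteq> 0"
  shows "\<exists>R k. marked_ruler_point R \<and> k \<noteq> 0 \<and> R = P + k *\<^sub>R (B - A)"
proof -
  define n where "n = norm (B - A)"
  have n: "n > 0"
    using cross by (auto simp: n_def cross_def)
  define e where "e = (1 / n) *\<^sub>R (B - A)"
  define f where "f = P - A"
  define c where "c = cross e f"
  obtain e1 e2 where e: "e = (e1, e2)" by (metis surj_pair)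
  obtain f1 f2 where f: "f = (f1, f2)" by (metis surj_pair)
  obtain a1 a2 where A: "A = (a1, a2)" by (metis surj_pair)
  have "c = cross (B - A) (P - A) / n"
    unfolding c_def e_def f_def by (simp add: cross_def diff_divide_distrib left_diff_distrib)
  then have c: "c \<noteq> 0" "c = e1 * f2 - e2 * f1"
    using cross n by (simp, simp add: c_def cross_def e f)
  have norm_e: "norm e = 1"
    using n by (simp add: e_def n_def)
  have P: "P = A + f"
    by (simp add: f_def)
  have norm_f: "norm f > 0"
    using c by (auto simp: f zero_prod_def)
  have A1: "marked_ruler_point (A + e)"
    using marked_ruler_point_unit[OF pts cross, of "1 / n"] n by (simp add: e_def n_def)
  have A2: "marked_ruler_point (A + 2 *\<^sub>R e)"
  proof -
    have "cross (A - (A + e)) (P - (A + e)) \<noteq> 0"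
      using c by (simp add: cross_def e f P algebra_simps)
    from marked_ruler_point_unit[OF A1 pts(1,3) this, of "-1"] show ?thesis
      using norm_e by (simp add: scaleR_2 add.assoc)
  qed
  \<comment> \<open>A unit step from \<open>P\<close> away from \<open>A\<close> reaches
    \<open>A + \<kappa> *\<^sub>R f\<close>.\<close>
  define \<kappa> where "\<kappa> = 1 + 1 / norm f"
  have \<kappa>: "\<kappa> > 1"
    using norm_f by (simp add: \<kappa>_def)
  have Z: "marked_ruler_point (A + \<kappa> *\<^sub>R f)"
  proof -
    have "cross (A - P) (A + e - P) \<noteq> 0"
      using c by (simp add: cross_def e f P algebra_simps)
    from marked_ruler_point_unit[OF pts(3,1) A1 this, of "- 1 / norm f"] norm_f show ?thesis
      by (simp add: \<kappa>_def P algebra_simps)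
  qed
  define m where "m = 2 * \<kappa> - 1"
  have m: "m > 0"
    using \<kappa> by (simp add: m_def)
  \<comment> \<open>Ceva's theorem in the triangle with vertices \<open>A\<close>,
    \<open>A + 2 *\<^sub>R e\<close> and \<open>A + \<kappa> *\<^sub>R f\<close>:
    \<open>A + e\<close> is the midpoint of the base, \<open>W\<close> the meet of the median with
    the cevian through \<open>P\<close>. The cevian from \<open>A\<close> through \<open>W\<close>
    then cuts the third side at the height of \<open>P\<close>.\<close>
  have W: "marked_ruler_point (A + ((2 * \<kappa> - 2) / m) *\<^sub>R e + (\<kappa> / m) *\<^sub>R f)"
  proof (rule marked_ruler_point_Int[OF Z A1 A2 pts(3)])
    show "A + ((2 * \<kappa> - 2) / m) *\<^sub>R e + (\<kappa> / m) *\<^sub>R f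
        = A + \<kappa> *\<^sub>R f + ((2 * \<kappa> - 2) / m) *\<^sub>R (A + e - (A + \<kappa> *\<^sub>R f))"
      using m by (simp add: A e f field_simps) (simp add: m_def algebra_simps)
    show "A + ((2 * \<kappa> - 2) / m) *\<^sub>R e + (\<kappa> / m) *\<^sub>R f
        = A + 2 *\<^sub>R e + (\<kappa> / m) *\<^sub>R (P - (A + 2 *\<^sub>R e))"
      using m by (simp add: A e f P field_simps) (simp add: m_def algebra_simps)
    have "cross (A + e - (A + \<kappa> *\<^sub>R f)) (P - (A + 2 *\<^sub>R e)) = - m * c"
      by (simp add: cross_def e f P c m_def algebra_simps)
    then show "cross (A + e - (A + \<kappa> *\<^sub>R f)) (P - (A + 2 *\<^sub>R e)) \<noteq> 0"
      using m c by simp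
  qed
  \<comment> \<open>The base has length 2, and similar triangles shrink it by
    \<open>(\<kappa> - 1) / \<kappa>\<close>.\<close>
  define k where "k = (2 * \<kappa> - 2) / \<kappa>"
  have R: "marked_ruler_point (P + k *\<^sub>R e)"
  proof (rule marked_ruler_point_Int[OF pts(1) W Z A2])
    show "P + k *\<^sub>R e = A + (m / \<kappa>) *\<^sub>R (A + ((2 * \<kappa> - 2) / m) *\<^sub>R e + (\<kappa> / m) *\<^sub>R f - A)"
    proof -
      have "m / \<kappa> * ((2 * \<kappa> - 2) / m) = k" "m / \<kappa> * (\<kappa> / m) = 1"
        using m \<kappa> by (simp_all add: k_def)
      moreover have "(m / \<kappa>) *\<^sub>R (A + ((2 * \<kappa> - 2) / m) *\<^sub>R e + (\<kappa> / m) *\<^sub>R f - A)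
          = (m / \<kappa> * ((2 * \<kappa> - 2) / m)) *\<^sub>R e + (m / \<kappa> * (\<kappa> / m)) *\<^sub>R f"
        by (simp add: scaleR_add_right)
      ultimately show ?thesis
        by (simp only: P scaleR_one add_ac)
    qed
    show "P + k *\<^sub>R e = A + \<kappa> *\<^sub>R f + ((\<kappa> - 1) / \<kappa>) *\<^sub>R (A + 2 *\<^sub>R e - (A + \<kappa> *\<^sub>R f))"
      using \<kappa> by (simp add: A e f P k_def field_simps)
    have "cross (A + ((2 * \<kappa> - 2) / m) *\<^sub>R e + (\<kappa> / m) *\<^sub>R f - A) (A + 2 *\<^sub>R e - (A + \<kappa> *\<^sub>R f))
        = - (2 * \<kappa>\<^sup>2 / m) * c"
      using m by (simp add: cross_def A e f P c field_simps power2_eq_square)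
    then show "cross (A + ((2 * \<kappa> - 2) / m) *\<^sub>R e + (\<kappa> / m) *\<^sub>R f - A) (A + 2 *\<^sub>R e - (A + \<kappa> *\<^sub>R f)) \<noteq> 0"
      using m c \<kappa> by simp
  qed
  show ?thesis
    using R \<kappa> n by (intro exI[of _ "P + k *\<^sub>R e"] exI[of _ "k / n"]) (auto simp: e_def k_def)
qed

text \<open>For \<open>P\<close> on the line, the parallel is the line itself, and \<open>A\<close>
  or \<open>B\<close> differs from \<open>P\<close>.\<close>

lemma marked_ruler_parallel:
  assumes pts: "marked_ruler_point A" "marked_ruler_point B" "marked_ruler_point P" and "A \<noteq> B"
  shows "\<exists>R k. marked_ruler_point R \<and> k \<noteq> 0 \<and> R = P + k *\<^sub>R (B - A)"
proof (cases "cross (B - A) (P - A) = 0")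
  case False
  then show ?thesis
    using marked_ruler_parallel_off_line pts by blast
next
  case True
  obtain t where "P - A = t *\<^sub>R (B - A)"
    using cross_eq_0D[OF True] \<open>A \<noteq> B\<close> by auto
  then have t: "P = A + t *\<^sub>R (B - A)"
    by (simp add: algebra_simps)
  show ?thesis
  proof (cases "t = 0")
    case True
    then show ?thesis
      using pts t by (intro exI[of _ B] exI[of _ 1]) simp
  next
    case False
    then show ?thesis
      using pts t by (intro exI[of _ A] exI[of _ "- t"]) simp
  qed
qed

lemma marked_ruler_point_parallels_Int:
  assumes pts: "marked_ruler_point A" "marked_ruler_point B" "marked_ruler_point C" "marked_ruler_point D"
      "marked_ruler_point P" "marked_ruler_point Q"
    and Z: "Z = P + u *\<^sub>R (B - A)" "Z = Q + v *\<^sub>R (D - C)" and cross: "cross (B - A) (D - C) \<noteq> 0"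
  shows "marked_ruler_point Z"
proof -
  have "A \<noteq> B" "C \<noteq> D"
    using cross by (auto simp: cross_def)
  then obtain R k R' k' where R: "marked_ruler_point R" "k \<noteq> 0" "R = P + k *\<^sub>R (B - A)"
    and R': "marked_ruler_point R'" "k' \<noteq> 0" "R' = Q + k' *\<^sub>R (D - C)"
    using marked_ruler_parallel[OF pts(1,2,5)] marked_ruler_parallel[OF pts(3,4,6)] by blast
  show ?thesis
  proof (rule marked_ruler_point_Int[OF pts(5) R(1) pts(6) R'(1)])
    show "Z = P + (u / k) *\<^sub>R (R - P)" "Z = Q + (v / k') *\<^sub>R (R' - Q)"
      using Z R R' by simp_all
    have "cross (R - P) (R' - Q) = k * k' * cross (B - A) (D - C)"
      unfolding R(3) R'(3) by (simp add: cross_def algebra_simps)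
    then show "cross (R - P) (R' - Q) \<noteq> 0"
      using cross R R' by simp
  qed
qed

section \<open>Arithmetic of the marked ruler numbers\<close>

lemma marked_ruler_numbers_iff: "x \<in> marked_ruler_numbers \<longleftrightarrow> marked_ruler_point (x, 0)"
  by (simp add: marked_ruler_numbers_def)

lemma marked_ruler_numbers_fst:
  assumes "marked_ruler_point (x, y)"
  shows "x \<in> marked_ruler_numbers"
  unfolding marked_ruler_numbers_iff
  by (rule marked_ruler_point_parallels_Int[OF marked_ruler_point_start(1,3,1,2) assms marked_ruler_point_start(1),
        where u = "- y" and v = x]) (simp_all add: cross_def)

text \<open>Parallels to \<open>x + y = 1\<close> exchange the axes.\<close>

lemma marked_ruler_point_on_y_axis:
  assumes "x \<in> marked_ruler_numbers"
  shows "marked_ruler_point (0, x)"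
  by (rule marked_ruler_point_parallels_Int[OF marked_ruler_point_start(2,3,1,3)
        assms[unfolded marked_ruler_numbers_iff] marked_ruler_point_start(1), where u = x and v = x])
     (simp_all add: cross_def)

lemma marked_ruler_numbers_snd:
  assumes "marked_ruler_point (x, y)"
  shows "y \<in> marked_ruler_numbers"
proof -
  have y: "marked_ruler_point (0, y)"
    by (rule marked_ruler_point_parallels_Int[OF marked_ruler_point_start(1,2,1,3) assms marked_ruler_point_start(1),
          where u = "- x" and v = y]) (simp_all add: cross_def)
  show ?thesis
    unfolding marked_ruler_numbers_iff
    by (rule marked_ruler_point_parallels_Int[OF marked_ruler_point_start(3,2,1,2) y marked_ruler_point_start(1),
          where u = y and v = y]) (simp_all add: cross_def)
qed

lemma marked_ruler_point_of_numbers: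
  assumes "x \<in> marked_ruler_numbers" "y \<in> marked_ruler_numbers"
  shows "marked_ruler_point (x, y)"
  by (rule marked_ruler_point_parallels_Int[OF marked_ruler_point_start(1,3,1,2)
        assms(1)[unfolded marked_ruler_numbers_iff] marked_ruler_point_on_y_axis[OF assms(2)],
        where u = y and v = x]) (simp_all add: cross_def)

lemma marked_ruler_numbers_0_1: "0 \<in> marked_ruler_numbers" "1 \<in> marked_ruler_numbers"
  using marked_ruler_point_start by (simp_all add: marked_ruler_numbers_iff)

lemma real_subfield_marked_ruler_numbers: "real_subfield marked_ruler_numbers"
proof
  show "1 \<in> marked_ruler_numbers"
    by (fact marked_ruler_numbers_0_1)
next
  fix a b assume mem: "a \<in> marked_ruler_numbers" "b \<in> marked_ruler_numbers"
  note pts = marked_ruler_point_of_numbers[OF mem(1) marked_ruler_numbers_0_1(2)]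
    marked_ruler_point_of_numbers[OF mem(2) marked_ruler_numbers_0_1(2)]
  \<comment> \<open>The parallel through \<open>(a, 1)\<close> to the line from the origin to
    \<open>(b, 1)\<close> meets the x-axis at \<open>a - b\<close>.\<close>
  show "a - b \<in> marked_ruler_numbers"
    unfolding marked_ruler_numbers_iff
    by (rule marked_ruler_point_parallels_Int[OF marked_ruler_point_start(1) pts(2) marked_ruler_point_start(1,2)
          pts(1) marked_ruler_point_start(1), where u = "- 1" and v = "a - b"]) (simp_all add: cross_def)
next
  fix a b assume mem: "a \<in> marked_ruler_numbers" "b \<in> marked_ruler_numbers" and "b \<noteq> 0"
  \<comment> \<open>The line from the origin to \<open>(b, a)\<close> has slope
    \<open>a / b\<close>, read off at \<open>x = 1\<close>.\<close>
  have "marked_ruler_point (1, a / b)"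
    by (rule marked_ruler_point_parallels_Int[OF marked_ruler_point_start(1) marked_ruler_point_of_numbers[OF mem(2,1)]
          marked_ruler_point_start(1,3) marked_ruler_point_start(1,2), where u = "1 / b" and v = "a / b"])
       (use \<open>b \<noteq> 0\<close> in \<open>simp_all add: cross_def\<close>)
  then show "a / b \<in> marked_ruler_numbers"
    by (rule marked_ruler_numbers_snd)
qed

interpretation marked_ruler: real_subfield marked_ruler_numbers
  by (fact real_subfield_marked_ruler_numbers)

section \<open>Cubic equations solved by a marking\<close>

text \<open>Put \<open>V = (0, 0)\<close>, let \<open>r\<close> be the line \<open>y = c\<close> and \<open>s\<close> the line \<open>S * x + B * y = c'\<close>. If the
  marked ruler has direction \<open>(ex, ey)\<close>, then \<open>ey * (S * ex + B * ey) = c' * ey - c * (S * ex + B * ey)\<close>,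
  and \<open>t = ey / (1 + ex)\<close> turns this into a quartic equation for \<open>t\<close>. The factor \<open>c0 * t - c3\<close> makes
  the given cubic a quartic of this shape.\<close>

lemma marked_ruler_numbers_generic_cubic:
  assumes mem: "c3 \<in> marked_ruler_numbers" "c2 \<in> marked_ruler_numbers" "c1 \<in> marked_ruler_numbers"
      "c0 \<in> marked_ruler_numbers"
    and generic: "c0\<^sup>2 + c3\<^sup>2 - c3 * c1 - c2 * c0 \<noteq> 0"
    and root: "c3 * t ^ 3 + c2 * t\<^sup>2 + c1 * t + c0 = 0" and "t \<noteq> 0"
  shows "t \<in> marked_ruler_numbers"
proof -
  \<comment> \<open>The quartic of a marking has leading coefficient \<open>m1\<close> and constant
    term \<open>- m1\<close>, its other coefficients being free. The factor
    \<open>c0 * t - c3\<close> gives the product this shape; comparing coefficients yields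
    \<open>S\<close>, \<open>B\<close>, \<open>m1\<close> and \<open>m2\<close>.\<close>
  define S where "S = (c0\<^sup>2 + c3\<^sup>2 - c3 * c1 - c2 * c0) / 4"
  define B where "B = (c1 * c0 - c3 * c2) / 4"
  define m1 where "m1 = c3 * c0"
  define m2 where "m2 = - (c0\<^sup>2 - c3\<^sup>2 - c3 * c1 + c2 * c0) / 4"
  \<comment> \<open>From \<open>m1 = - c * S\<close> and \<open>m2 = c' - c * B\<close>, the
    right-hand side of the conic of the marking.\<close>
  define c where "c = - m1 / S"
  define c' where "c' = m2 + c * B"
  have S: "S \<noteq> 0"
    using generic by (simp add: S_def)
  have mem': "S \<in> marked_ruler_numbers" "B \<in> marked_ruler_numbers" "c \<in> marked_ruler_numbers"
    "c' \<in> marked_ruler_numbers"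
    unfolding c'_def c_def S_def B_def m1_def m2_def using mem by (auto intro!: marked_ruler.mem_intros)
  define D where "D = 1 + t\<^sup>2"
  have D: "D > 0"
    by (simp add: D_def add_pos_nonneg)
  define ex ey where "ex = (1 - t\<^sup>2) / D" and "ey = 2 * t / D"
  have exD: "ex * D = 1 - t\<^sup>2" "ey * D = 2 * t"
    using D by (simp_all add: ex_def ey_def)
  have ey: "ey \<noteq> 0"
    using D \<open>t \<noteq> 0\<close> by (simp add: ey_def)
  have "D\<^sup>2 * (ex\<^sup>2 + ey\<^sup>2) = (ex * D)\<^sup>2 + (ey * D)\<^sup>2"
    by (simp add: power2_eq_square algebra_simps)
  also have "\<dots> = D\<^sup>2"
    unfolding exD by (simp add: D_def power2_eq_square algebra_simps)
  finally have unit: "ex\<^sup>2 + ey\<^sup>2 = 1"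
    using D by simp
  have "(2 * t) * (S * (1 - t\<^sup>2) + B * (2 * t)) - (m1 * (1 - t\<^sup>2) + m2 * (2 * t)) * (1 + t\<^sup>2)
      = (c3 * t ^ 3 + c2 * t\<^sup>2 + c1 * t + c0) * (c0 * t - c3)"
    by (simp add: S_def B_def m1_def m2_def field_simps power2_eq_square power3_eq_cube)
  then have "(ey * D) * (S * (ex * D) + B * (ey * D)) - (m1 * (ex * D) + m2 * (ey * D)) * D = 0"
    unfolding exD using root by (simp add: D_def)
  then have "D\<^sup>2 * (ey * (S * ex + B * ey) - (m1 * ex + m2 * ey)) = 0"
    by (simp add: power2_eq_square algebra_simps)
  then have conic: "ey * (S * ex + B * ey) = m1 * ex + m2 * ey"
    using D by simp
  \<comment> \<open>The signed distance from the origin to \<open>P\<close> along the ruler.\<close>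
  define \<rho> where "\<rho> = c / ey"
  define P Q where "P = (\<rho> * ex, \<rho> * ey)" and "Q = ((\<rho> + 1) * ex, (\<rho> + 1) * ey)"
  have cS: "c * S = - m1"
    using S by (simp add: c_def)
  have "(c + ey) * (S * ex + B * ey) - c' * ey = 0"
    using conic cS unfolding c'_def by Groebner_Basis.algebra
  then have *: "(c + ey) * (S * ex + B * ey) = c' * ey"
    by simp
  have "S * ((\<rho> + 1) * ex) + B * ((\<rho> + 1) * ey) = (\<rho> + 1) * (S * ex + B * ey)"
    by (simp add: algebra_simps)
  moreover have "\<rho> + 1 = (c + ey) / ey"
    using ey by (simp add: \<rho>_def add_divide_distrib)
  moreover have "(c + ey) / ey * (S * ex + B * ey) = c'"
    unfolding times_divide_eq_left * using ey by simp
  ultimately have Qs: "Q \<in> line_eqn S B c'"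
    unfolding Q_def mem_line_eqn by simp
  have Pr: "P \<in> line_eqn 0 1 c"
    using ey by (simp add: P_def \<rho>_def)
  have r: "line_through (0, c) (1, c) = line_eqn 0 1 c"
    by (rule line_through_eqnI) auto
  have s: "line_through (c' / S, 0) (c' / S - B, S) = line_eqn S B c'"
    by (rule line_through_eqnI) (use S in \<open>auto simp: field_simps\<close>)
  have rs: "line_through (0, c) (1, c) \<noteq> line_through (c' / S, 0) (c' / S - B, S)"
  proof
    assume "line_through (0, c) (1, c) = line_through (c' / S, 0) (c' / S - B, S)"
    then have "(c' / S, 0) \<in> line_eqn 0 1 c" "(c' / S - B, S) \<in> line_eqn 0 1 c"
      unfolding r s using S by (simp_all add: field_simps)
    then show False using S by simp
  qed
  have dist: "dist P Q = 1" "dist Q P = 1"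
    using unit by (simp_all add: P_def Q_def dist_Pair_Pair dist_real_def algebra_simps)
  have coll: "collinear {(0, 0), P, Q}" "collinear {(0, 0), Q, P}"
  proof -
    have "collinear (range (\<lambda>u. u *\<^sub>R (ex, ey)))"
      unfolding collinear_alt by (intro exI[of _ 0] exI[of _ "(ex, ey)"]) auto
    moreover have "{(0, 0), P, Q} \<subseteq> range (\<lambda>u. u *\<^sub>R (ex, ey))"
      by (auto simp: P_def Q_def image_iff intro: exI[of _ 0])
    ultimately show "collinear {(0, 0), P, Q}"
      by (rule collinear_subset)
    then show "collinear {(0, 0), Q, P}"
      by (simp add: insert_commute)
  qed
  have pts: "marked_ruler_point (0, c)" "marked_ruler_point (1, c)"
    "marked_ruler_point (c' / S, 0)" "marked_ruler_point (c' / S - B, S)"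
    using mem' by (auto intro!: marked_ruler_point_of_numbers marked_ruler.mem_intros)
  have neq: "(0 :: real, c) \<noteq> (1, c)" "(c' / S, 0) \<noteq> (c' / S - B, S)"
    using S by auto
  \<comment> \<open>Exchanging the two lines constructs the other marked point as well; the
    difference of the two is the direction of the ruler.\<close>
  have "marked_ruler_point P"
    using marked_ruler_point_mark[OF pts marked_ruler_point_start(1) neq rs _ _ dist(1) coll(1)] Pr Qs
    unfolding r s by blast
  moreover have "marked_ruler_point Q"
    using marked_ruler_point_mark[OF pts(3,4,1,2) marked_ruler_point_start(1) neq(2,1) rs[symmetric]
        _ _ dist(2) coll(2)] Pr Qs
    unfolding r s by blast
  ultimately have "(\<rho> + 1) * ex - \<rho> * ex \<in> marked_ruler_numbers" "(\<rho> + 1) * ey - \<rho> * ey \<in> marked_ruler_numbers"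
    unfolding P_def Q_def
    using marked_ruler.diff_mem marked_ruler_numbers_fst marked_ruler_numbers_snd by blast+
  then have "ex \<in> marked_ruler_numbers" "ey \<in> marked_ruler_numbers"
    by (simp_all add: algebra_simps)
  moreover have "t = ey / (1 + ex)"
  proof -
    have "1 + ex = 2 / D"
      using D by (simp add: ex_def D_def field_simps)
    then show ?thesis
      using D by (simp add: ey_def)
  qed
  ultimately show ?thesis
    by (auto intro!: marked_ruler.mem_intros)
qed

lemma cubic_closed_marked_ruler_numbers: "cubic_closed_subfield marked_ruler_numbers"
proof
  fix a b c d x
  assume mem: "a \<in> marked_ruler_numbers" "b \<in> marked_ruler_numbers" "c \<in> marked_ruler_numbers"
      "d \<in> marked_ruler_numbers"
    and nz: "(a, b, c, d) \<noteq> (0, 0, 0, 0)" and root: "a * x ^ 3 + b * x\<^sup>2 + c * x + d = 0"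
  show "x \<in> marked_ruler_numbers"
  proof (cases "x = 0 \<or> a = 0 \<and> d = 0")
    case True
    have "x = - c / b" if "x \<noteq> 0"
    proof -
      have "(b * x + c) * x = 0"
        using that True root by (simp add: power2_eq_square algebra_simps)
      then have *: "b * x + c = 0"
        using that by simp
      then have "b \<noteq> 0"
        using that True nz by auto
      moreover have "x * b = - c"
        using * by (simp add: eq_neg_iff_add_eq_0 mult.commute)
      ultimately show ?thesis
        by (metis nonzero_eq_divide_eq)
    qed
    then have "x = 0 \<or> x = - c / b"
      by blast
    then show ?thesis
      using mem by (auto intro!: marked_ruler.mem_intros)
  next
    case False
    \<comment> \<open>Dividing the root by \<open>l\<close> rescales the coefficients to
      \<open>a * l^3\<close>, \<open>b * l^2\<close>, \<open>c * l\<close> and \<open>d\<close>. The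
      quantity required to be nonzero becomes the value of \<open>p\<close> at \<open>l\<close>, and
      some positive integer is not a root of \<open>p\<close>.\<close>
    define p where "p = [:d\<^sup>2, 0, - b * d, 0, - a * c, 0, a\<^sup>2:]"
    have "p \<noteq> 0"
      using False by (auto simp: p_def)
    then have "finite {z. poly p z = 0}"
      by (rule poly_roots_finite)
    moreover have "infinite (of_nat ` {0<..} :: real set)"
      by (subst finite_image_iff) (auto simp: infinite_Ioi)
    ultimately have "\<not> (of_nat ` {0<..} :: real set) \<subseteq> {z. poly p z = 0}"
      using finite_subset by blast
    then obtain n :: nat where n: "n > 0" "poly p (of_nat n) \<noteq> 0"
      by auto
    define l where "l = real n"
    have l: "l \<noteq> 0" "l \<in> marked_ruler_numbers"
      using n marked_ruler.of_nat_mem by (auto simp: l_def)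
    have "x / l \<in> marked_ruler_numbers"
    proof (rule marked_ruler_numbers_generic_cubic)
      show "a * l ^ 3 \<in> marked_ruler_numbers" "b * l\<^sup>2 \<in> marked_ruler_numbers"
        "c * l \<in> marked_ruler_numbers" "d \<in> marked_ruler_numbers"
        using mem l by (auto intro!: marked_ruler.mem_intros)
      have "d\<^sup>2 + (a * l ^ 3)\<^sup>2 - a * l ^ 3 * (c * l) - b * l\<^sup>2 * d = poly p l"
        by (simp add: p_def algebra_simps power2_eq_square power3_eq_cube)
      then show "d\<^sup>2 + (a * l ^ 3)\<^sup>2 - a * l ^ 3 * (c * l) - b * l\<^sup>2 * d \<noteq> 0"
        using n by (simp add: l_def)
      show "a * l ^ 3 * (x / l) ^ 3 + b * l\<^sup>2 * (x / l)\<^sup>2 + c * l * (x / l) + d = 0"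
        using root l by (simp add: power_divide)
      show "x / l \<noteq> 0"
        using False l by simp
    qed
    then show ?thesis
      using marked_ruler.mult_mem[of "x / l" l] l by simp
  qed
qed

section \<open>Coordinates of marked ruler points\<close>

context cubic_closed_subfield
begin

lemma unit_normal_mem:
  assumes K: "a \<in> K" "b \<in> K" and nz: "(a, b) \<noteq> (0, 0)"
    and e: "e1\<^sup>2 + e2\<^sup>2 = 1" "a * e1 + b * e2 = 0"
  shows "e1 \<in> K" "e2 \<in> K"
proof -
  have N: "a\<^sup>2 + b\<^sup>2 \<noteq> 0"
    using nz by (auto simp: sum_power2_eq_zero_iff)
  have "e1\<^sup>2 * (a\<^sup>2 + b\<^sup>2) = b\<^sup>2" "e2\<^sup>2 * (a\<^sup>2 + b\<^sup>2) = a\<^sup>2"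
    using e by Groebner_Basis.algebra+
  then have "e1\<^sup>2 = b\<^sup>2 / (a\<^sup>2 + b\<^sup>2)" "e2\<^sup>2 = a\<^sup>2 / (a\<^sup>2 + b\<^sup>2)"
    by (simp_all add: nonzero_eq_divide_eq[OF N])
  then show "e1 \<in> K" "e2 \<in> K"
    using K quadratic_root_mem[of 0 "- (b\<^sup>2 / (a\<^sup>2 + b\<^sup>2))" e1]
      quadratic_root_mem[of 0 "- (a\<^sup>2 / (a\<^sup>2 + b\<^sup>2))" e2]
    by (simp_all add: mem_intros)
qed

lemma unit_conic_mem:
  assumes K: "a \<in> K" "b \<in> K" "a' \<in> K" "b' \<in> K" "m1 \<in> K" "m2 \<in> K"
    and nz: "(a, b) \<noteq> (0, 0)" "(a', b') \<noteq> (0, 0)"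
    and e: "e1\<^sup>2 + e2\<^sup>2 = 1" "(a * e1 + b * e2) * (a' * e1 + b' * e2) = m1 * e1 + m2 * e2"
  shows "e1 \<in> K \<and> e2 \<in> K"
proof (cases "e1 = - 1")
  case True
  \<comment> \<open>The one point of the circle that the half-angle parametrization misses.\<close>
  then show ?thesis using e by (auto intro!: mem_intros)
next
  case False
  define t where "t = e2 / (1 + e1)"
  define D where "D = 1 + t\<^sup>2"
  have D: "D > 0"
    by (simp add: D_def add_pos_nonneg)
  have f: "1 + e1 \<noteq> 0"
    using False by linarith
  then have te: "t * (1 + e1) = e2"
    by (simp add: t_def)
  have "(1 + e1) * ((1 + e1) * D - 2) = 0"
  proof -
    have "(1 + e1) * ((1 + e1) * D - 2) = (1 + e1)\<^sup>2 + (t * (1 + e1))\<^sup>2 - 2 * (1 + e1)"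
      by (simp add: D_def power2_eq_square algebra_simps)
    also have "\<dots> = 0"
      using e(1) unfolding te by (simp add: power2_eq_square algebra_simps)
    finally show ?thesis .
  qed
  then have "(1 + e1) * D = 2"
    using f by simp
  moreover have "e2 * D = t * ((1 + e1) * D)"
    by (simp flip: te)
  ultimately have eD: "e1 * D = 1 - t\<^sup>2" "e2 * D = 2 * t"
    by (simp_all add: D_def algebra_simps)
  have "(a * (e1 * D) + b * (e2 * D)) * (a' * (e1 * D) + b' * (e2 * D)) = (m1 * (e1 * D) + m2 * (e2 * D)) * D"
    using e(2) by Groebner_Basis.algebra
  then have eq: "(a * (1 - t\<^sup>2) + b * (2 * t)) * (a' * (1 - t\<^sup>2) + b' * (2 * t))
      = (m1 * (1 - t\<^sup>2) + m2 * (2 * t)) * (1 + t\<^sup>2)"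
    unfolding eD unfolding D_def .
  define A B S where "A = a * a'" and "B = b * b'" and "S = a * b' + a' * b"
  have "(A + m1) * t ^ 4 + (- 2 * S - 2 * m2) * t ^ 3 + (4 * B - 2 * A) * t\<^sup>2 + (2 * S - 2 * m2) * t + (A - m1) = 0"
    using eq unfolding A_def B_def S_def by Groebner_Basis.algebra
  \<comment> \<open>\<open>A\<close>, \<open>S\<close> and \<open>B\<close> are the coefficients of
    the product of two nonzero linear forms, so they cannot all vanish.\<close>
  moreover have "(A + m1, - 2 * S - 2 * m2, 4 * B - 2 * A, 2 * S - 2 * m2, A - m1) \<noteq> (0, 0, 0, 0, 0)"
  proof
    assume "(A + m1, - 2 * S - 2 * m2, 4 * B - 2 * A, 2 * S - 2 * m2, A - m1) = (0, 0, 0, 0, 0)"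
    then have "A = 0" "B = 0" "S = 0" by auto
    then show False
      using nz unfolding A_def B_def S_def by auto
  qed
  moreover have "A + m1 \<in> K" "- 2 * S - 2 * m2 \<in> K" "4 * B - 2 * A \<in> K" "2 * S - 2 * m2 \<in> K" "A - m1 \<in> K"
    using K by (auto intro!: mem_intros simp: A_def B_def S_def)
  ultimately have "t \<in> K"
    using quartic_root_mem[of "A + m1" "- 2 * S - 2 * m2" "4 * B - 2 * A" "2 * S - 2 * m2" "A - m1" t]
    by blast
  moreover have "e1 = (1 - t\<^sup>2) / D" "e2 = 2 * t / D"
    using eD D by (simp_all add: field_simps)
  ultimately show ?thesis
    by (auto simp: D_def intro!: mem_intros)
qed

lemma marking_over:
  assumes r: "line_over r" and s: "line_over s" and neq: "r \<noteq> s" and V: "V \<in> K \<times> K"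
    and P: "P \<in> r" and Q: "Q \<in> s" and mark: "dist P Q = 1" "collinear {V, P, Q}"
  shows "P \<in> K \<times> K"
proof -
  obtain a b c where K: "a \<in> K" "b \<in> K" "c \<in> K" and nz: "(a, b) \<noteq> (0, 0)" and r_eq: "r = line_eqn a b c"
    using r unfolding line_over_def by blast
  obtain a' b' c' where K': "a' \<in> K" "b' \<in> K" "c' \<in> K" and nz': "(a', b') \<noteq> (0, 0)" and s_eq: "s = line_eqn a' b' c'"
    using s unfolding line_over_def by blast
  obtain v1 v2 where V_eq: "V = (v1, v2)" by (metis surj_pair)
  obtain e1 e2 where e: "Q - P = (e1, e2)" by (metis surj_pair)
  have Q_eq: "Q = P + (e1, e2)"
    using e by (simp add: algebra_simps)
  have unit: "e1\<^sup>2 + e2\<^sup>2 = 1"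
    using mark(1) dist_norm[of Q P] by (simp add: dist_commute[of Q] e norm_Pair)
  have "P \<noteq> Q"
    using mark(1) by auto
  moreover have "collinear {P, Q, V}"
    using mark(2) by (simp add: insert_commute)
  ultimately have "V \<in> line_through P Q"
    unfolding line_through_def using collinear_3_affine_hull by blast
  then obtain u where "V = P + u *\<^sub>R (e1, e2)"
    unfolding mem_line_through_iff e by blast
  then have P_eq: "P = (v1 + (- u) * e1, v2 + (- u) * e2)"
    using V_eq by (cases P) auto
  define \<rho> where "\<rho> = - u"
  note P_eq = P_eq[folded \<rho>_def]
  have vK: "v1 \<in> K" "v2 \<in> K"
    using V V_eq by auto
  \<comment> \<open>The constants of the two lines after moving \<open>V\<close> to the
    origin.\<close>
  define d d' where "d = c - a * v1 - b * v2" and "d' = c' - a' * v1 - b' * v2"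
  have dK: "d \<in> K" "d' \<in> K"
    unfolding d_def d'_def using K K' vK by (auto intro!: mem_intros)
  have Pd: "\<rho> * (a * e1 + b * e2) = d"
    using P unfolding r_eq P_eq d_def by (simp add: algebra_simps)
  have Qd: "(\<rho> + 1) * (a' * e1 + b' * e2) = d'"
    using Q unfolding s_eq Q_eq P_eq d'_def by (simp add: algebra_simps)
  consider "a * e1 + b * e2 = 0" | "a' * e1 + b' * e2 = 0" | "a * e1 + b * e2 \<noteq> 0" "a' * e1 + b' * e2 \<noteq> 0"
    by blast
  then show ?thesis
  proof cases
    case 1
    \<comment> \<open>The ruler lies along \<open>r\<close>, so \<open>Q\<close> is the intersection
      of the lines and \<open>P\<close> is one unit away from it along \<open>r\<close>.\<close>
    then have "Q \<in> r"
      using P unfolding r_eq Q_eq P_eq by (simp add: algebra_simps)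
    then have "Q \<in> K \<times> K"
      using line_over_Int[OF r s neq] Q by blast
    then show ?thesis
      using unit_normal_mem[OF K(1,2) nz unit 1] diff_mem unfolding Q_eq
      by (cases P) (auto dest: diff_mem[of _ e1] diff_mem[of _ e2])
  next
    case 2
    then have "P \<in> s"
      using Q unfolding s_eq Q_eq P_eq by (simp add: algebra_simps)
    then show ?thesis
      using line_over_Int[OF r s neq] P by blast
  next
    case 3
    \<comment> \<open>Eliminating \<open>\<rho>\<close> from \<open>Pd\<close> and \<open>Qd\<close>
      gives the conic for the direction.\<close>
    have "(a * e1 + b * e2) * (a' * e1 + b' * e2) = (d' * a - d * a') * e1 + (d' * b - d * b') * e2"
      unfolding Pd[symmetric] Qd[symmetric] by (simp add: algebra_simps)
    then have "e1 \<in> K \<and> e2 \<in> K"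
      by (rule unit_conic_mem[rotated -1]) (use K K' dK nz nz' unit in \<open>auto intro!: mem_intros\<close>)
    moreover have "\<rho> = d / (a * e1 + b * e2)"
      using Pd 3(1) by (simp add: field_simps)
    ultimately show ?thesis
      unfolding P_eq using K dK vK by (auto intro!: mem_intros)
  qed
qed

lemma lines_of_over:
  assumes "S \<subseteq> K \<times> K" "l \<in> lines_of S"
  shows "line_over l"
proof -
  obtain A B where AB: "A \<in> S" "B \<in> S" "A \<noteq> B" "l = line_through A B"
    using assms(2) unfolding lines_of_def by blast
  then have "fst A \<in> K" "snd A \<in> K" "fst B \<in> K" "snd B \<in> K"
    using assms(1) by auto
  then show ?thesis
    unfolding AB(4) line_through_eqn[OF AB(3)] using AB(3)
    by (intro line_overI) (auto simp: prod_eq_iff intro!: mem_intros)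
qed

lemma marked_ruler_point_over: "marked_ruler_point P \<Longrightarrow> P \<in> K \<times> K"
  unfolding marked_ruler_point_iff
proof (erule constructible_induct)
  fix S P assume "\<And>A. A \<in> S \<Longrightarrow> A \<in> K \<times> K" and step: "marked_ruler_step S P"
  then have S: "S \<subseteq> K \<times> K" by blast
  from step show "P \<in> K \<times> K"
    unfolding marked_ruler_step_def
  proof (elim disjE)
    assume "P \<in> marked_ruler_start"
    then show ?thesis
      unfolding marked_ruler_start_def by (auto intro: mem_intros)
  next
    assume "intersection_point (lines_of S) P"
    then show ?thesis
      using line_over_Int lines_of_over[OF S] unfolding intersection_point_def by blast
  next
    assume "marking_step S P"
    then show ?thesis
      unfolding marking_step_def using marking_over lines_of_over[OF S] S by (meson subsetD)
  qed
qed

end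

theorem mainTheorem2:
  shows "(\<forall>P. origami_point P \<longleftrightarrow> marked_ruler_point P) \<and>
    subfield origami_numbers real_field \<and> subfield marked_ruler_numbers real_field \<and>
    real_field\<lparr>carrier := origami_numbers\<rparr> \<simeq> real_field\<lparr>carrier := marked_ruler_numbers\<rparr>"
proof -
  interpret O: cubic_closed_subfield origami_numbers
    by (rule cubic_closed_origami_numbers)
  interpret L: cubic_closed_subfield marked_ruler_numbers
    by (rule cubic_closed_marked_ruler_numbers)
  have points: "origami_point P \<longleftrightarrow> marked_ruler_point P" for P
  proof
    assume "origami_point P"
    then show "marked_ruler_point P"
      using L.origami_point_over marked_ruler_point_of_numbers by (cases P) blast
  next
    assume "marked_ruler_point P"
    then show "origami_point P"
      using O.marked_ruler_point_over origami_point_of_numbers by (cases P) blast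
  qed
  \<comment> \<open>The two subfields coincide, so the identity is the isomorphism.\<close>
  then have "origami_numbers = marked_ruler_numbers"
    by (simp add: origami_numbers_def marked_ruler_numbers_def)
  then show ?thesis
    using points O.subfield ring_iso_refl by simp
qed

end
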